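(* Let $A(s)=\sum_{j=0}^{q}A_{j+1}s^j\in\mathbb C[s]^{m\times n}$ be a polynomial matrix, and let $M(s)=\sum_{j=0}^{m_q}M_{j+1}s^j\in\mathbb C[s]^{m\times m}$ and $N(s)=\sum_{j=0}^{n_q}N_{j+1}s^j\in\mathbb C[s]^{n\times n}$ be positive definite. With the notation $a_{i,j+1}$, $\widehat A_{i,j+1}$, $N_{i-1,j+1}$, $L_{i,j+1}$, $\widehat n_{i,j+1}$, $\overline N_{i-1,j+1}$, $\overline{\overline N}_{i-1,j+1}$, $\overline n_q$, $\overline{\overline n}_q$ of the context, define $Z_{i,j+1}$ ($0\le j\le q_i$) and scalars $Y_{i,j+1}$ ($0\le j\le p_i$), for $i=1,\dots,n$, by the following algorithm. Step 1 (initial values). Put $q_1=q+m_q$, $p_1=2q+m_q$. If $a_1(s)\neq 0$, put $$Z_{1,j+1}=\sum_{k=0}^{j}a_{1,j-k+1}^*M_{k+1}\ (0\le j\le q_1),\qquad Y_{1,j+1}=\sum_{r=0}^{j}\sum_{k=0}^{j-r}a_{1,j-k-r+1}^*M_{k+1}a_{1,r+1}\ (0\le j\le p_1).$$ If $a_1(s)=0$, put $Z_{1,j+1}=0$ for all $j$, and take the denominator $\sum_jY_{1,j+1}s^j$ to be the constant $1$. Step 2 (recursive step). For $i=2,\dots,n$: Step 2.1. For $0\le j\le q_{i-1}+q$ put $d_{i,j+1}=\sum_{k=0}^jZ_{i-1,j-k+1}a_{i,k+1}$. Step 2.2. Let $\hat q_{i-1}=\max\{p_{i-1},q_{i-1}+q\}$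 and for $0\le j\le\hat q_{i-1}+q$ put $$c_{i,j+1}=\sum_{k=0}^j\left(a_{i,j-k+1}Y_{i-1,k+1}-\widehat A_{i-1,j-k+1}d_{i,k+1}\right).$$ Step 2.3. Put $$\varphi_{i,j+1}=\sum_{t=0}^j\sum_{r=0}^{j-t}\sum_{k=0}^{j-t-r}\left(Y_{i-1,j-k-r-t+1}I_{i-1,k+1}-Z_{i-1,j-k-r-t+1}\widehat A_{i-1,k+1}\right)\overline N_{i-1,r+1}L_{i,t+1},\quad 0\le j\le\hat q_{i-1}+\overline n_q+n_q,$$ $$\psi_{i,j+1}=\sum_{k=0}^jY_{i-1,j-k+1}\overline{\overline N}_{i-1,k+1},\quad 0\le j\le p_{i-1}+\overline{\overline n}_q.$$ (a) If $c_{i,j+1}\ne0$ for some $j$, put $$V_{i,j+1}=\sum_{r=0}^j\sum_{k=0}^{j-r}Y_{i-1,j-k-r+1}c_{i,k+1}^*M_{r+1},\quad 0\le j\le\overline b_i=\hat q_{i-1}+q+p_{i-1}+m_q,$$ $$W_{i,j+1}=\sum_{r=0}^j\sum_{k=0}^{j-r}c_{i,j-k-r+1}^*M_{k+1}c_{i,r+1},\quad 0\le j\le\overline{\overline b}_i=2\hat q_{i-1}+2q+m_q.$$ (b) If $c_{i,j+1}=0$ for all $j$, put $$\overline\Delta_{i,j+1}=\sum_{r=0}^j\sum_{k=0}^{j-r}Y_{i-1,j-k-r+1}Y_{i-1,k+1}\overline{\overline N}_{i-1,r+1},\quad 0\le j\le 2p_{i-1}+\overline{\overline n}_q,$$ $$\begin{aligned}\overline{\overline\Delta}_{i,j+1}=&\sum_{t=0}^j\sum_{r=0}^{j-t}\sum_{k=0}^{j-r-t}\Big(\widehat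 n_{i,j-k-r-t+1}Y_{i-1,k+1}Y_{i-1,r+1}+d_{i,j-k-r-t+1}^*N_{i-1,k+1}d_{i,r+1}\\&\quad-d_{i,j-k-r-t+1}^*L_{i,k+1}Y_{i-1,r+1}-L_{i,j-k-r-t+1}^*d_{i,k+1}Y_{i-1,r+1}\Big)\overline{\overline N}_{i-1,t+1}\\&-\sum_{r=0}^j\sum_{k=0}^{j-r}L_{i,j-k-r+1}^*\varphi_{i,k+1}Y_{i-1,r+1},\quad 0\le j\le 2\hat q_{i-1}+n_q+\max\{n_q+\overline n_q,\overline{\overline n}_q\},\end{aligned}$$ and then $$V_{i,j+1}=\sum_{t=0}^j\sum_{r=0}^{j-t}\sum_{k=0}^{j-t-r}\overline\Delta_{i,j-k-r-t+1}\left(d_{i,k+1}^*N_{i-1,r+1}-L_{i,k+1}^*Y_{i-1,r+1}\right)Z_{i-1,t+1},$$ $$0\le j\le\overline b_i=2p_{i-1}+\overline{\overline n}_q+q_{i-1}+\hat q_{i-1}+n_q,$$ $$W_{i,j+1}=\sum_{r=0}^j\sum_{k=0}^{j-r}\overline{\overline\Delta}_{i,j-k-r+1}Y_{i-1,k+1}Y_{i-1,r+1},$$ $$0\le j\le\overline{\overline b}_i=2\hat q_{i-1}+n_q+\max\{n_q+\overline n_q,\overline{\overline n}_q\}+2p_{i-1}.$$ In both cases put $$q_i=\hat q_{i-1}+q+\max\{\overline n_q+n_q,\overline{\overline n}_q\}+\max\{\overline b_i,\overline{\overline b}_i\},\qquad p_i=p_{i-1}+\overline{\overline n}_q+\overline{\overline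 b}_i,$$ $$\Theta_{i,j+1}=\sum_{r=0}^j\sum_{k=0}^{j-r}\left(Z_{i-1,j-k-r+1}\overline{\overline N}_{i-1,k+1}W_{i,r+1}-d_{i,j-k-r+1}\overline{\overline N}_{i-1,k+1}V_{i,r+1}\right)-\sum_{k=0}^j\varphi_{i,j-k+1}V_{i,k+1},$$ $$Z_{i,j+1}=\begin{bmatrix}\Theta_{i,j+1}\\[2pt]\sum_{k=0}^j\psi_{i,j-k+1}V_{i,k+1}\end{bmatrix}\ (0\le j\le q_i),\qquad Y_{i,j+1}=\sum_{k=0}^j\psi_{i,j-k+1}W_{i,k+1}\ (0\le j\le p_i).$$ Step 2.4. Put $X_i(s)=\dfrac{\sum_{j=0}^{q_i}Z_{i,j+1}s^j}{\sum_{j=0}^{p_i}Y_{i,j+1}s^j}$ (and likewise $X_1(s)$ for $i=1$). Step 3. Stop at $i=n$ and return $X_n(s)$. Then the algorithm computes the weighted Moore-Penrose inverse of $A(s)$: all the divisions are well defined and $A(s)^\dagger_{M,N}=X_n(s)$.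
   Context: Conventions. $\mathbb C[s]$ and $\mathbb C(s)$ are the polynomials and rational functions in an indeterminate $s$, treated as real: $*$ denotes conjugate transpose with $s$ fixed, so $\left(\sum_jB_js^j\right)^*=\sum_jB_j^*s^j$. A square matrix $M(s)$ over $\mathbb C(s)$ is called positive definite if $M(s)^*=M(s)$ and $M(t)$ is a positive definite complex matrix for all real $t$ in some nonempty open interval. Weighted Moore-Penrose inverse. For $A\in\mathbb C(s)^{m\times n}$ and positive definite $M\in\mathbb C(s)^{m\times m}$, $N\in\mathbb C(s)^{n\times n}$, the matrix $A^\dagger_{M,N}$ is the unique $X\in\mathbb C(s)^{n\times m}$ with $AXA=A$, $XAX=X$, $(MAX)^*=MAX$, $(NXA)^*=NXA$. Notation. $a_i(s)=\sum_{j=0}^qa_{i,j+1}s^j$ is the $i$-th column of $A(s)$ (the $a_{i,j+1}$ are constant $m\times1$ vectors). $\widehat A_i(s)=\sum_{j=0}^q\widehat A_{i,j+1}s^j$ is the submatrix of the first $i$ columns of $A(s)$ (the $\widehat A_{i,j+1}$ are constant $m\times i$ matrices). $N_i(s)$ is the $i\times i$ leading principal submatrix of $N(s)$, partitioned for $i\ge2$ as $$N_i(s)=\begin{bmatrix}N_{i-1}(s)&l_i(s)\\ l_i^*(s)&n_{ii}(s)\end{bmatrix},$$ with $N_{i-1}(s)=\sum_{j=0}^{n_q}N_{i-1,j+1}s^j$, $l_i(s)=\sum_{j=0}^{n_q}L_{i,j+1}s^j$, $n_{ii}(s)=\sum_{j=0}^{n_q}\widehat n_{i,j+1}s^j$ (doubly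 indexed symbols $N_{i-1,j+1}$ are coefficients of $N_{i-1}(s)$, not of $N(s)$). The inverse is given in the form $$N_{i-1}^{-1}(s)=\frac{\sum_{j=0}^{\overline n_q}\overline N_{i-1,j+1}s^j}{\sum_{j=0}^{\overline{\overline n}_q}\overline{\overline N}_{i-1,j+1}s^j},$$ with constant $(i-1)\times(i-1)$ matrices $\overline N_{i-1,j+1}$ and a nonzero scalar denominator polynomial with real coefficients $\overline{\overline N}_{i-1,j+1}$; the degree bounds $\overline n_q,\overline{\overline n}_q$ may depend on $i$ (in step $i$ they are those of $N_{i-1}^{-1}$). $I_{i-1,1}$ is the $(i-1)\times(i-1)$ identity matrix and $I_{i-1,k+1}=0$ for $k\ge1$. Every coefficient whose index lies outside its stated range is understood to be zero. *)

theory Defs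
  imports
    "HOL-Computational_Algebra.Polynomial_Factorial"
    "Jordan_Normal_Form.Matrix"
    "Jordan_Normal_Form.Schur_Decomposition"
begin

section \<open>Matrices over $\mathbb{C}(s)$\<close>

text \<open>The field of rational functions is \<^typ>\<open>complex poly fract\<close>. The indeterminate $s$ is treated
  as real, so conjugation acts on the coefficients only.\<close>

definition fract_cnj :: "complex poly fract \<Rightarrow> complex poly fract" where
  "fract_cnj x =
     (THE y. \<exists>a b. b \<noteq> 0 \<and> x = Fract a b \<and> y = Fract (map_poly cnj a) (map_poly cnj b))"

lemma fract_cnj_Fract:
  assumes "b \<noteq> 0"
  shows "fract_cnj (Fract a b) = Fract (map_poly cnj a) (map_poly cnj b)"
  unfolding fract_cnj_def
proof (rule the_equality)
  have mult: "map_poly cnj (x * y) = map_poly cnj x * map_poly cnj y" for x y :: "complex poly"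
    by (rule poly_eqI) (simp add: coeff_map_poly coeff_mult)
  have zero: "map_poly cnj x = 0 \<longleftrightarrow> x = 0" for x :: "complex poly"
    by (simp add: map_poly_eq_0_iff)
  fix y
  assume "\<exists>c d. d \<noteq> 0 \<and> Fract a b = Fract c d \<and> y = Fract (map_poly cnj c) (map_poly cnj d)"
  then obtain c d where d: "d \<noteq> 0" and eq: "Fract a b = Fract c d"
    and y: "y = Fract (map_poly cnj c) (map_poly cnj d)"
    by blast
  have "a * d = c * b"
    using eq d assms by (simp add: eq_fract)
  then have "map_poly cnj a * map_poly cnj d = map_poly cnj c * map_poly cnj b"
    by (simp flip: mult)
  then show "y = Fract (map_poly cnj a) (map_poly cnj b)"
    using d assms by (simp add: y eq_fract zero)
qed (use assms in blast)

text \<open>\<^const>\<open>mat_adjoint\<close> requires the entries to come from a type of class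
  \<^class>\<open>conjugatable_field\<close>; it is used for constant matrices, and \<open>ratmat_adjoint\<close> for matrices
  over $\mathbb{C}(s)$.\<close>

definition ratmat_adjoint :: "complex poly fract mat \<Rightarrow> complex poly fract mat" where
  "ratmat_adjoint A = map_mat fract_cnj (transpose_mat A)"

text \<open>\<open>has_value_at r z w\<close>: the rational function \<open>r\<close> has no pole at \<open>z\<close> and takes the value \<open>w\<close>
  there.\<close>

definition has_value_at :: "complex poly fract \<Rightarrow> complex \<Rightarrow> complex \<Rightarrow> bool" where
  "has_value_at r z w \<longleftrightarrow>
     (\<exists>a b. poly b z \<noteq> 0 \<and> r = Fract a b \<and> w = poly a z / poly b z)"

text \<open>Here \<open>0 < x\<close> for complex \<open>x\<close> means that \<open>x\<close> is real and positive, and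
  \<open>(C *\<^sub>v v) \<bullet>c v\<close> is $v^* C v$.\<close>

definition pos_def_mat :: "nat \<Rightarrow> complex mat \<Rightarrow> bool" where
  "pos_def_mat n C \<longleftrightarrow> C \<in> carrier_mat n n \<and> mat_adjoint C = C \<and>
     (\<forall>v \<in> carrier_vec n. v \<noteq> 0\<^sub>v n \<longrightarrow> 0 < (C *\<^sub>v v) \<bullet>c v)"

definition pos_def_ratmat :: "nat \<Rightarrow> complex poly fract mat \<Rightarrow> bool" where
  "pos_def_ratmat n M \<longleftrightarrow> M \<in> carrier_mat n n \<and> ratmat_adjoint M = M \<and>
     (\<exists>a b :: real. a < b \<and> (\<forall>t. a < t \<and> t < b \<longrightarrow>
        (\<exists>C. pos_def_mat n C \<and>
             (\<forall>i<n. \<forall>j<n. has_value_at (M $$ (i, j)) (complex_of_real t) (C $$ (i, j))))))"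

definition is_weighted_MP ::
  "complex poly fract mat \<Rightarrow> complex poly fract mat \<Rightarrow> complex poly fract mat \<Rightarrow>
   complex poly fract mat \<Rightarrow> bool" where
  "is_weighted_MP M N A X \<longleftrightarrow>
     X \<in> carrier_mat (dim_col A) (dim_row A) \<and>
     A * X * A = A \<and>
     X * A * X = X \<and>
     ratmat_adjoint (M * A * X) = M * A * X \<and>
     ratmat_adjoint (N * X * A) = N * X * A"

definition weighted_MP ::
  "complex poly fract mat \<Rightarrow> complex poly fract mat \<Rightarrow> complex poly fract mat \<Rightarrow>
   complex poly fract mat" where
  "weighted_MP M N A = (THE X. is_weighted_MP M N A X)"

abbreviation ratmat :: "complex poly mat \<Rightarrow> complex poly fract mat" where
  "ratmat A \<equiv> map_mat to_fract A"

definition mat_degree_le :: "complex poly mat \<Rightarrow> nat \<Rightarrow> bool" where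
  "mat_degree_le A b \<longleftrightarrow> (\<forall>i < dim_row A. \<forall>j < dim_col A. degree (A $$ (i, j)) \<le> b)"

definition leading_submat :: "nat \<Rightarrow> 'a mat \<Rightarrow> 'a mat" where
  "leading_submat i N = mat i i (\<lambda>(r, c). N $$ (r, c))"

section \<open>The algorithm\<close>

text \<open>\<^typ>\<open>'a mat\<close> is not a monoid (the zero depends on the dimensions), so finite sums of
  matrices are taken entrywise.\<close>

definition msum :: "nat \<Rightarrow> nat \<Rightarrow> nat set \<Rightarrow> (nat \<Rightarrow> complex mat) \<Rightarrow> complex mat" where
  "msum nr nc K f = mat nr nc (\<lambda>(r, c). \<Sum>k\<in>K. f k $$ (r, c))"

text \<open>A coefficient sequence given by \<open>f\<close> for the indices \<open>0, \<dots>, b\<close> and equal to \<open>z\<close> (zero)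
  outside this range.\<close>

definition upto_deg :: "nat \<Rightarrow> 'a \<Rightarrow> (nat \<Rightarrow> 'a) \<Rightarrow> nat \<Rightarrow> 'a" where
  "upto_deg b z f j = (if j \<le> b then f j else z)"

text \<open>The outcome of one step: \<open>Zc j\<close>, \<open>Yc j\<close> are $Z_{i,j+1}$, $Y_{i,j+1}$, and \<open>Zdeg\<close>, \<open>Ydeg\<close> are
  $q_i$, $p_i$.\<close>

record wmp_state =
  Zc :: "nat \<Rightarrow> complex mat"
  Yc :: "nat \<Rightarrow> complex"
  Zdeg :: nat
  Ydeg :: nat

text \<open>Throughout, the argument \<open>j\<close> of a coefficient sequence is the power of $s$, so \<open>f j\<close> stands for
  $f_{j+1}$. The index \<open>i\<close> is the number of the step, while rows and columns of
  matrices are numbered from \<open>0\<close>; column vectors and scalars obtained from matrix products are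
  matrices with one column, respectively the entry of a \<open>1 \<times> 1\<close> matrix. \<open>Nnum k\<close> and \<open>Nden k\<close>
  are the numerator and the denominator of $N_k^{-1}(s)$ with degree bounds \<open>nnd k\<close> and \<open>ndd k\<close>,
  i.e. $\overline{n}_q$ and $\overline{\overline{n}}_q$ of step \<open>i = k + 1\<close>. The argument
  \<open>S\<close> of the definitions for step \<open>i\<close> is the outcome of step \<open>i - 1\<close>.\<close>

locale wmp_algorithm =
  fixes m q mq nq :: nat
    and A M N :: "complex poly mat"
    and Nnum :: "nat \<Rightarrow> complex poly mat"
    and Nden :: "nat \<Rightarrow> complex poly"
    and nnd ndd :: "nat \<Rightarrow> nat"
begin

definition a_coef :: "nat \<Rightarrow> nat \<Rightarrow> complex mat" where
  "a_coef i j = mat m 1 (\<lambda>(r, c). coeff (A $$ (r, i - 1)) j)"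

definition Ahat_coef :: "nat \<Rightarrow> nat \<Rightarrow> complex mat" where
  "Ahat_coef i j = mat m i (\<lambda>(r, c). coeff (A $$ (r, c)) j)"

definition M_coef :: "nat \<Rightarrow> complex mat" where
  "M_coef j = map_mat (\<lambda>p. coeff p j) M"

definition N_coef :: "nat \<Rightarrow> nat \<Rightarrow> complex mat" where
  "N_coef i j = map_mat (\<lambda>p. coeff p j) (leading_submat i N)"

definition L_coef :: "nat \<Rightarrow> nat \<Rightarrow> complex mat" where
  "L_coef i j = mat (i - 1) 1 (\<lambda>(r, c). coeff (N $$ (r, i - 1)) j)"

definition n_coef :: "nat \<Rightarrow> nat \<Rightarrow> complex" where
  "n_coef i j = coeff (N $$ (i - 1, i - 1)) j"

definition Nnum_coef :: "nat \<Rightarrow> nat \<Rightarrow> complex mat" where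
  "Nnum_coef k j = map_mat (\<lambda>p. coeff p j) (Nnum k)"

definition Nden_coef :: "nat \<Rightarrow> nat \<Rightarrow> complex" where
  "Nden_coef k j = coeff (Nden k) j"

definition I_coef :: "nat \<Rightarrow> nat \<Rightarrow> complex mat" where
  "I_coef k j = (if j = 0 then 1\<^sub>m k else 0\<^sub>m k k)"

definition init_state :: wmp_state where
  "init_state =
     (if \<exists>j. a_coef 1 j \<noteq> 0\<^sub>m m 1 then
        \<lparr> Zc = upto_deg (q + mq) (0\<^sub>m 1 m)
               (\<lambda>j. msum 1 m {..j} (\<lambda>k. mat_adjoint (a_coef 1 (j - k)) * M_coef k)),
          Yc = upto_deg (2 * q + mq) 0
               (\<lambda>j. \<Sum>r\<le>j. \<Sum>k\<le>j - r.
                  (mat_adjoint (a_coef 1 (j - k - r)) * M_coef k * a_coef 1 r) $$ (0, 0)),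
          Zdeg = q + mq,
          Ydeg = 2 * q + mq \<rparr>
      else
        \<lparr> Zc = (\<lambda>j. 0\<^sub>m 1 m),
          Yc = (\<lambda>j. if j = 0 then 1 else 0),
          Zdeg = q + mq,
          Ydeg = 2 * q + mq \<rparr>)"

definition d_coef :: "nat \<Rightarrow> wmp_state \<Rightarrow> nat \<Rightarrow> complex mat" where
  "d_coef i S = upto_deg (Zdeg S + q) (0\<^sub>m (i - 1) 1)
     (\<lambda>j. msum (i - 1) 1 {..j} (\<lambda>k. Zc S (j - k) * a_coef i k))"

definition qhat :: "wmp_state \<Rightarrow> nat" where
  "qhat S = max (Ydeg S) (Zdeg S + q)"

definition c_coef :: "nat \<Rightarrow> wmp_state \<Rightarrow> nat \<Rightarrow> complex mat" where
  "c_coef i S = upto_deg (qhat S + q) (0\<^sub>m m 1)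
     (\<lambda>j. msum m 1 {..j} (\<lambda>k.
        Yc S k \<cdot>\<^sub>m a_coef i (j - k) - Ahat_coef (i - 1) (j - k) * d_coef i S k))"

definition phi_coef :: "nat \<Rightarrow> wmp_state \<Rightarrow> nat \<Rightarrow> complex mat" where
  "phi_coef i S = upto_deg (qhat S + nnd (i - 1) + nq) (0\<^sub>m (i - 1) 1)
     (\<lambda>j. msum (i - 1) 1 {..j} (\<lambda>t. msum (i - 1) 1 {..j - t} (\<lambda>r.
        msum (i - 1) 1 {..j - t - r} (\<lambda>k.
          (Yc S (j - k - r - t) \<cdot>\<^sub>m I_coef (i - 1) k
             - Zc S (j - k - r - t) * Ahat_coef (i - 1) k)
          * Nnum_coef (i - 1) r * L_coef i t))))"

definition psi_coef :: "nat \<Rightarrow> wmp_state \<Rightarrow> nat \<Rightarrow> complex" where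
  "psi_coef i S = upto_deg (Ydeg S + ndd (i - 1)) 0
     (\<lambda>j. \<Sum>k\<le>j. Yc S (j - k) * Nden_coef (i - 1) k)"

definition c_nonzero :: "nat \<Rightarrow> wmp_state \<Rightarrow> bool" where
  "c_nonzero i S \<longleftrightarrow> (\<exists>j. c_coef i S j \<noteq> 0\<^sub>m m 1)"

definition Va_deg :: "wmp_state \<Rightarrow> nat" where
  "Va_deg S = qhat S + q + Ydeg S + mq"

definition Va_coef :: "nat \<Rightarrow> wmp_state \<Rightarrow> nat \<Rightarrow> complex mat" where
  "Va_coef i S = upto_deg (Va_deg S) (0\<^sub>m 1 m)
     (\<lambda>j. msum 1 m {..j} (\<lambda>r. msum 1 m {..j - r} (\<lambda>k.
        Yc S (j - k - r) \<cdot>\<^sub>m (mat_adjoint (c_coef i S k) * M_coef r))))"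

definition Wa_deg :: "wmp_state \<Rightarrow> nat" where
  "Wa_deg S = 2 * qhat S + 2 * q + mq"

definition Wa_coef :: "nat \<Rightarrow> wmp_state \<Rightarrow> nat \<Rightarrow> complex" where
  "Wa_coef i S = upto_deg (Wa_deg S) 0
     (\<lambda>j. \<Sum>r\<le>j. \<Sum>k\<le>j - r.
        (mat_adjoint (c_coef i S (j - k - r)) * M_coef k * c_coef i S r) $$ (0, 0))"

definition Delta1_coef :: "nat \<Rightarrow> wmp_state \<Rightarrow> nat \<Rightarrow> complex" where
  "Delta1_coef i S = upto_deg (2 * Ydeg S + ndd (i - 1)) 0
     (\<lambda>j. \<Sum>r\<le>j. \<Sum>k\<le>j - r. Yc S (j - k - r) * Yc S k * Nden_coef (i - 1) r)"

definition Delta2_deg :: "nat \<Rightarrow> wmp_state \<Rightarrow> nat" where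
  "Delta2_deg i S = 2 * qhat S + nq + max (nq + nnd (i - 1)) (ndd (i - 1))"

definition Delta2_coef :: "nat \<Rightarrow> wmp_state \<Rightarrow> nat \<Rightarrow> complex" where
  "Delta2_coef i S = upto_deg (Delta2_deg i S) 0
     (\<lambda>j. (\<Sum>t\<le>j. \<Sum>r\<le>j - t. \<Sum>k\<le>j - r - t.
             (n_coef i (j - k - r - t) * Yc S k * Yc S r
              + (mat_adjoint (d_coef i S (j - k - r - t)) * N_coef (i - 1) k * d_coef i S r) $$ (0, 0)
              - (mat_adjoint (d_coef i S (j - k - r - t)) * L_coef i k) $$ (0, 0) * Yc S r
              - (mat_adjoint (L_coef i (j - k - r - t)) * d_coef i S k) $$ (0, 0) * Yc S r)
             * Nden_coef (i - 1) t)
          - (\<Sum>r\<le>j. \<Sum>k\<le>j - r.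
               (mat_adjoint (L_coef i (j - k - r)) * phi_coef i S k) $$ (0, 0) * Yc S r))"

definition Vb_deg :: "nat \<Rightarrow> wmp_state \<Rightarrow> nat" where
  "Vb_deg i S = 2 * Ydeg S + ndd (i - 1) + Zdeg S + qhat S + nq"

definition Vb_coef :: "nat \<Rightarrow> wmp_state \<Rightarrow> nat \<Rightarrow> complex mat" where
  "Vb_coef i S = upto_deg (Vb_deg i S) (0\<^sub>m 1 m)
     (\<lambda>j. msum 1 m {..j} (\<lambda>t. msum 1 m {..j - t} (\<lambda>r. msum 1 m {..j - t - r} (\<lambda>k.
        Delta1_coef i S (j - k - r - t) \<cdot>\<^sub>m
          ((mat_adjoint (d_coef i S k) * N_coef (i - 1) r
              - Yc S r \<cdot>\<^sub>m mat_adjoint (L_coef i k)) * Zc S t)))))"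

definition Wb_deg :: "nat \<Rightarrow> wmp_state \<Rightarrow> nat" where
  "Wb_deg i S = 2 * qhat S + nq + max (nq + nnd (i - 1)) (ndd (i - 1)) + 2 * Ydeg S"

definition Wb_coef :: "nat \<Rightarrow> wmp_state \<Rightarrow> nat \<Rightarrow> complex" where
  "Wb_coef i S = upto_deg (Wb_deg i S) 0
     (\<lambda>j. \<Sum>r\<le>j. \<Sum>k\<le>j - r. Delta2_coef i S (j - k - r) * Yc S k * Yc S r)"

definition V_deg :: "nat \<Rightarrow> wmp_state \<Rightarrow> nat" where
  "V_deg i S = (if c_nonzero i S then Va_deg S else Vb_deg i S)"

definition V_coef :: "nat \<Rightarrow> wmp_state \<Rightarrow> nat \<Rightarrow> complex mat" where
  "V_coef i S = (if c_nonzero i S then Va_coef i S else Vb_coef i S)"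

definition W_deg :: "nat \<Rightarrow> wmp_state \<Rightarrow> nat" where
  "W_deg i S = (if c_nonzero i S then Wa_deg S else Wb_deg i S)"

definition W_coef :: "nat \<Rightarrow> wmp_state \<Rightarrow> nat \<Rightarrow> complex" where
  "W_coef i S = (if c_nonzero i S then Wa_coef i S else Wb_coef i S)"

definition Theta_coef :: "nat \<Rightarrow> wmp_state \<Rightarrow> nat \<Rightarrow> complex mat" where
  "Theta_coef i S j =
     msum (i - 1) m {..j} (\<lambda>r. msum (i - 1) m {..j - r} (\<lambda>k.
       (Nden_coef (i - 1) k * W_coef i S r) \<cdot>\<^sub>m Zc S (j - k - r)
       - Nden_coef (i - 1) k \<cdot>\<^sub>m (d_coef i S (j - k - r) * V_coef i S r)))
     - msum (i - 1) m {..j} (\<lambda>k. phi_coef i S (j - k) * V_coef i S k)"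

definition next_Zdeg :: "nat \<Rightarrow> wmp_state \<Rightarrow> nat" where
  "next_Zdeg i S = qhat S + q + max (nnd (i - 1) + nq) (ndd (i - 1)) + max (V_deg i S) (W_deg i S)"

definition next_Ydeg :: "nat \<Rightarrow> wmp_state \<Rightarrow> nat" where
  "next_Ydeg i S = Ydeg S + ndd (i - 1) + W_deg i S"

definition step :: "nat \<Rightarrow> wmp_state \<Rightarrow> wmp_state" where
  "step i S =
     \<lparr> Zc = upto_deg (next_Zdeg i S) (0\<^sub>m i m)
            (\<lambda>j. Theta_coef i S j
                 @\<^sub>r msum 1 m {..j} (\<lambda>k. psi_coef i S (j - k) \<cdot>\<^sub>m V_coef i S k)),
       Yc = upto_deg (next_Ydeg i S) 0
            (\<lambda>j. \<Sum>k\<le>j. psi_coef i S (j - k) * W_coef i S k),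
       Zdeg = next_Zdeg i S,
       Ydeg = next_Ydeg i S \<rparr>"

text \<open>The steps are numbered from \<open>1\<close>; \<open>state 0\<close> is left unspecified.\<close>

fun state :: "nat \<Rightarrow> wmp_state" where
  "state (Suc 0) = init_state"
| "state (Suc (Suc i)) = step (Suc (Suc i)) (state (Suc i))"

definition X_num :: "nat \<Rightarrow> complex poly mat" where
  "X_num i = mat i m (\<lambda>(r, c). \<Sum>j\<le>Zdeg (state i). monom (Zc (state i) j $$ (r, c)) j)"

definition X_den :: "nat \<Rightarrow> complex poly" where
  "X_den i = (\<Sum>j\<le>Ydeg (state i). monom (Yc (state i) j) j)"

definition X :: "nat \<Rightarrow> complex poly fract mat" where
  "X i = map_mat (\<lambda>p. to_fract p / to_fract (X_den i)) (X_num i)"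

end

end

theory Submission
  imports Defs
begin

text \<open>
  Let $X$ be the weighted inverse of the first $k$ columns $B$, and let $a$ be the next column.
  With $d = Xa$, $c = a - Bd$ and $p = (I - XB) N_k^{-1} l$, the weighted inverse of $[B\ a]$ has the
  rows $X - (d + p) b$ and $b$, where $b = (c^* M c)^{-1} c^* M$ if $c \neq 0$ and
  $b = \delta^{-1} (d^* N_k - l^*) X$ if $c = 0$. Here $\delta$ is the value of the form $N_{k+1}$ at
  the vector $(d + p, -1)$, so that it does not vanish. The algorithm computes these matrices with a
  common denominator: writing $X = Z / Y$ with $Y$ real, each of its coefficient sequences is a
  convolution, that is, the coefficient sequence of a product of polynomial matrices whose degree
  does not exceed the prescribed bound. In particular the truncations never cut anything off.
\<close>

section \<open>Matrix algebra with dimension side conditions\<close>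

text \<open>Positivity at sample points cannot be computed with inside the field of rational
  functions. It enters through anisotropy: a self-adjoint form that vanishes only at zero. This
  restricts to leading blocks and keeps the scalars inverted in the row \<open>b\<close> nonzero.
  The row \<open>b\<close> has a geometric origin. \<open>I - X B\<close> is the projection onto
  \<open>ker B\<close> that is orthogonal for \<open>N_k\<close>; hence \<open>p\<close> makes
  \<open>v = (d + p, -1)\<close> orthogonal to all \<open>(u, 0)\<close> with
  \<open>B u = 0\<close>, and \<open>[B a] v = -c\<close>. If \<open>c = 0\<close>, then
  \<open>v\<close> spans what the kernel has gained, and the new inverse is \<open>(X, 0)\<close>
  minus its orthogonal projection onto \<open>v\<close>; the last row of this correction gives
  \<open>b\<close>. If \<open>c\<close> is nonzero, \<open>b\<close> kills the columns of
  \<open>B\<close>, is 1 on \<open>a\<close>, and makes \<open>c b\<close> the orthogonal projection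
  onto \<open>c\<close>. The denominator must be real because the algorithm multiplies by
  \<open>Y\<close> where adjoints produce its conjugate. Reality survives each step: the new factors
  are real denominators and values of self-adjoint forms.\<close>

lemma mat_mult_assoc:
  fixes A B C :: "'a::semiring_0 mat"
  shows "dim_col A = dim_row B \<Longrightarrow> dim_col B = dim_row C \<Longrightarrow> A * B * C = A * (B * C)"
  by (rule assoc_mult_mat) auto

lemma mat_mult_add_left:
  fixes A B C :: "'a::semiring_0 mat"
  shows "dim_col A = dim_row B \<Longrightarrow> dim_row B = dim_row C \<Longrightarrow> dim_col B = dim_col C \<Longrightarrow>
    A * (B + C) = A * B + A * C"
  by (rule mult_add_distrib_mat) auto

lemma mat_mult_add_right:
  fixes A B C :: "'a::semiring_0 mat"
  shows "dim_col A = dim_row C \<Longrightarrow> dim_row A = dim_row B \<Longrightarrow> dim_col A = dim_col B \<Longrightarrow>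
    (A + B) * C = A * C + B * C"
  by (rule add_mult_distrib_mat) auto

lemma mat_mult_minus_left:
  fixes A B C :: "'a::ring mat"
  shows "dim_col A = dim_row B \<Longrightarrow> dim_row B = dim_row C \<Longrightarrow> dim_col B = dim_col C \<Longrightarrow>
    A * (B - C) = A * B - A * C"
  by (rule mult_minus_distrib_mat) auto

lemma mat_mult_minus_right:
  fixes A B C :: "'a::ring mat"
  shows "dim_col A = dim_row C \<Longrightarrow> dim_row A = dim_row B \<Longrightarrow> dim_col A = dim_col B \<Longrightarrow>
    (A - B) * C = A * C - B * C"
  by (rule minus_mult_distrib_mat) auto

lemma mat_mult_smult_left:
  fixes A B :: "'a::comm_semiring_0 mat"
  shows "dim_col A = dim_row B \<Longrightarrow> (x \<cdot>\<^sub>m A) * B = x \<cdot>\<^sub>m (A * B)"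
  by (rule mult_smult_assoc_mat) auto

lemma mat_mult_smult_right:
  fixes A B :: "'a::comm_semiring_0 mat"
  shows "dim_col A = dim_row B \<Longrightarrow> A * (x \<cdot>\<^sub>m B) = x \<cdot>\<^sub>m (A * B)"
  by (rule mult_smult_distrib) auto

lemma mat_smult_add:
  fixes A B :: "'a::semiring_0 mat"
  shows "dim_row A = dim_row B \<Longrightarrow> dim_col A = dim_col B \<Longrightarrow> x \<cdot>\<^sub>m (A + B) = x \<cdot>\<^sub>m A + x \<cdot>\<^sub>m B"
  by (rule eq_matI) (auto simp: algebra_simps)

lemma mat_smult_minus:
  fixes A B :: "'a::ring mat"
  shows "dim_row A = dim_row B \<Longrightarrow> dim_col A = dim_col B \<Longrightarrow> x \<cdot>\<^sub>m (A - B) = x \<cdot>\<^sub>m A - x \<cdot>\<^sub>m B"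
  by (rule eq_matI) (auto simp: algebra_simps)

lemma mat_smult_smult: "x \<cdot>\<^sub>m (y \<cdot>\<^sub>m A) = (x * y :: 'a::semigroup_mult) \<cdot>\<^sub>m A"
  by (rule eq_matI) (auto simp: mult.assoc)

lemma mat_smult_one: "(1 :: 'a::monoid_mult) \<cdot>\<^sub>m A = A"
  by (rule eq_matI) auto

lemma mat_minus_self [simp]: "A - A = (0\<^sub>m (dim_row A) (dim_col A) :: 'a::group_add mat)"
  by (rule eq_matI) auto

lemma mat_add_zero [simp]:
  fixes A :: "'a::group_add mat"
  assumes "dim_row A = k" "dim_col A = l"
  shows "A + 0\<^sub>m k l = A" "0\<^sub>m k l + A = A" "A - 0\<^sub>m k l = A"
  using assms by (auto intro!: eq_matI)

text \<open>A normal form for the simplifier: sums distributed, scalars in front, products bracketed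
  to the right. Because of this bracketing, an identity meant for rewriting inside longer products
  is also needed with a further factor \<open>C\<close> on the right.\<close>

lemmas mat_algebra = mat_mult_assoc mat_mult_add_left mat_mult_add_right mat_mult_minus_left
  mat_mult_minus_right mat_mult_smult_left mat_mult_smult_right mat_smult_add mat_smult_minus
  mat_smult_smult mat_smult_one

section \<open>Conjugation on rational functions and adjoint matrices\<close>

lemma cnj_poly_mult: "map_poly cnj (p * q) = map_poly cnj p * map_poly cnj q"
  by (rule poly_eqI) (simp add: coeff_map_poly coeff_mult)

lemma cnj_poly_add: "map_poly cnj (p + q) = map_poly cnj p + map_poly cnj q"
  by (rule poly_eqI) (simp add: coeff_map_poly)

lemma cnj_poly_eq_0_iff: "map_poly cnj p = 0 \<longleftrightarrow> p = 0"
  by (simp add: map_poly_eq_0_iff)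

lemma cnj_poly_cnj_poly: "map_poly cnj (map_poly cnj p) = p"
  by (rule poly_eqI) (simp add: coeff_map_poly)

lemma fract_cnj_to_fract: "fract_cnj (to_fract p) = to_fract (map_poly cnj p)"
  by (simp add: to_fract_def fract_cnj_Fract)

lemma fract_cnj_0 [simp]: "fract_cnj 0 = 0"
  and fract_cnj_1 [simp]: "fract_cnj 1 = 1"
  using fract_cnj_to_fract[of 0] fract_cnj_to_fract[of 1] by simp_all

lemma fract_cnj_mult: "fract_cnj (x * y) = fract_cnj x * fract_cnj y"
  by (cases x; cases y) (simp add: fract_cnj_Fract cnj_poly_mult)

lemma fract_cnj_add: "fract_cnj (x + y) = fract_cnj x + fract_cnj y"
  by (cases x; cases y) (simp add: fract_cnj_Fract cnj_poly_mult cnj_poly_add cnj_poly_eq_0_iff)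

lemma fract_cnj_fract_cnj [simp]: "fract_cnj (fract_cnj x) = x"
  by (cases x) (simp add: fract_cnj_Fract cnj_poly_cnj_poly cnj_poly_eq_0_iff)

lemma fract_cnj_uminus: "fract_cnj (- x) = - fract_cnj x"
proof -
  have "fract_cnj (- x) + fract_cnj x = 0"
    by (simp flip: fract_cnj_add)
  then show ?thesis
    by (simp add: eq_neg_iff_add_eq_0)
qed

lemma fract_cnj_diff: "fract_cnj (x - y) = fract_cnj x - fract_cnj y"
  using fract_cnj_add[of x "- y"] by (simp add: fract_cnj_uminus)

lemma fract_cnj_sum: "fract_cnj (sum f S) = (\<Sum>i\<in>S. fract_cnj (f i))"
  by (induction S rule: infinite_finite_induct) (auto simp: fract_cnj_add)

lemma fract_cnj_inverse: "fract_cnj (inverse x) = inverse (fract_cnj x)"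
proof (cases "x = 0")
  case False
  then have "fract_cnj (inverse x) * fract_cnj x = 1"
    by (simp flip: fract_cnj_mult)
  then show ?thesis
    by (metis inverse_unique inverse_inverse_eq)
qed simp

lemma dim_ratmat_adjoint [simp]:
  "dim_row (ratmat_adjoint A) = dim_col A"
  "dim_col (ratmat_adjoint A) = dim_row A"
  by (simp_all add: ratmat_adjoint_def)

lemma index_ratmat_adjoint:
  "i < dim_col A \<Longrightarrow> j < dim_row A \<Longrightarrow> ratmat_adjoint A $$ (i, j) = fract_cnj (A $$ (j, i))"
  by (simp add: ratmat_adjoint_def)

lemma carrier_ratmat_adjoint [simp]:
  "ratmat_adjoint A \<in> carrier_mat k l \<longleftrightarrow> A \<in> carrier_mat l k"
  by (metis carrier_matD carrier_matI dim_ratmat_adjoint)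

lemma ratmat_adjoint_adjoint [simp]: "ratmat_adjoint (ratmat_adjoint A) = A"
  by (rule eq_matI) (simp_all add: index_ratmat_adjoint)

lemma ratmat_adjoint_mult:
  assumes "dim_col A = dim_row B"
  shows "ratmat_adjoint (A * B) = ratmat_adjoint B * ratmat_adjoint A"
  using assms
  by (intro eq_matI)
    (auto simp: index_ratmat_adjoint scalar_prod_def fract_cnj_sum fract_cnj_mult mult.commute)

lemma ratmat_adjoint_add:
  "dim_row A = dim_row B \<Longrightarrow> dim_col A = dim_col B \<Longrightarrow>
    ratmat_adjoint (A + B) = ratmat_adjoint A + ratmat_adjoint B"
  by (rule eq_matI) (simp_all add: index_ratmat_adjoint fract_cnj_add)

lemma ratmat_adjoint_minus:
  "dim_row A = dim_row B \<Longrightarrow> dim_col A = dim_col B \<Longrightarrow>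
    ratmat_adjoint (A - B) = ratmat_adjoint A - ratmat_adjoint B"
  by (rule eq_matI) (simp_all add: index_ratmat_adjoint fract_cnj_diff)

lemma ratmat_adjoint_smult: "ratmat_adjoint (x \<cdot>\<^sub>m A) = fract_cnj x \<cdot>\<^sub>m ratmat_adjoint A"
  by (rule eq_matI) (simp_all add: index_ratmat_adjoint fract_cnj_mult)

lemma ratmat_adjoint_zero [simp]: "ratmat_adjoint (0\<^sub>m k l) = 0\<^sub>m l k"
  by (rule eq_matI) (simp_all add: index_ratmat_adjoint)

lemma ratmat_adjoint_one [simp]: "ratmat_adjoint (1\<^sub>m k) = 1\<^sub>m k"
  by (rule eq_matI) (simp_all add: index_ratmat_adjoint)

lemma ratmat_adjoint_four_block:
  assumes "A \<in> carrier_mat k l" "B \<in> carrier_mat k l'" "C \<in> carrier_mat k' l" "D \<in> carrier_mat k' l'"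
  shows "ratmat_adjoint (four_block_mat A B C D) =
    four_block_mat (ratmat_adjoint A) (ratmat_adjoint C) (ratmat_adjoint B) (ratmat_adjoint D)"
  using assms by (intro eq_matI) (auto simp: index_ratmat_adjoint)

lemmas ratmat_adjoint_algebra = ratmat_adjoint_mult ratmat_adjoint_add ratmat_adjoint_minus
  ratmat_adjoint_smult

section \<open>Uniqueness of the weighted inverse\<close>

text \<open>Vectors are one-column matrices and the value of the form is a \<open>1 x 1\<close>
  matrix, so that the same product and adjoint rules cover everything.\<close>

definition anisotropic :: "nat \<Rightarrow> complex poly fract mat \<Rightarrow> bool" where
  "anisotropic n M \<longleftrightarrow> M \<in> carrier_mat n n \<and> ratmat_adjoint M = M \<and>
     (\<forall>v \<in> carrier_mat n 1. v \<noteq> 0\<^sub>m n 1 \<longrightarrow> ratmat_adjoint v * M * v \<noteq> 0\<^sub>m 1 1)"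

lemma anisotropicD:
  assumes "anisotropic n M"
  shows "M \<in> carrier_mat n n" "ratmat_adjoint M = M" "dim_row M = n" "dim_col M = n"
  using assms by (auto simp: anisotropic_def)

text \<open>A vector killed by \<open>M\<close> is isotropic, hence zero; this is applied to each
  column of \<open>A - B\<close>.\<close>

lemma anisotropic_mult_cancel:
  assumes M: "anisotropic n M" and A: "A \<in> carrier_mat n k" and B: "B \<in> carrier_mat n k"
    and eq: "M * A = M * B"
  shows "A = B"
proof (rule eq_matI)
  fix i j
  assume ij: "i < dim_row B" "j < dim_col B"
  define v where "v = mat n 1 (\<lambda>(i, _). A $$ (i, j) - B $$ (i, j))"
  have v: "v \<in> carrier_mat n 1"
    by (simp add: v_def)
  have "M * v = mat n 1 (\<lambda>(i, _). (M * A) $$ (i, j) - (M * B) $$ (i, j))"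
    using anisotropicD[OF M] A B ij
    by (intro eq_matI) (auto simp: v_def scalar_prod_def right_diff_distrib sum_subtractf)
  also have "\<dots> = 0\<^sub>m n 1"
    by (intro eq_matI) (auto simp: eq)
  finally have "ratmat_adjoint v * M * v = 0\<^sub>m 1 1"
    using v anisotropicD[OF M] by (simp add: mat_mult_assoc)
  then have "v = 0\<^sub>m n 1"
    using M v by (auto simp: anisotropic_def)
  then have "v $$ (i, 0) = 0"
    using ij B by simp
  then show "A $$ (i, j) = B $$ (i, j)"
    using ij B by (simp add: v_def)
qed (use A B in auto)

text \<open>An orthogonal projection is determined by its range (first alternative) or by its kernel
  (second). Taking adjoints reverses a product of maps that are self-adjoint for \<open>H\<close>,
  so \<open>H Q P = (P Q)^* H\<close>; this turns one half of the hypothesis into the other and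
  gives \<open>H P = H Q\<close>.\<close>

lemma selfadjoint_projections_eq:
  assumes H: "anisotropic k H" and P: "P \<in> carrier_mat k k" and Q: "Q \<in> carrier_mat k k"
    and PQ: "P * Q = Q \<and> Q * P = P \<or> P * Q = P \<and> Q * P = Q"
    and HP: "ratmat_adjoint (H * P) = H * P" and HQ: "ratmat_adjoint (H * Q) = H * Q"
  shows "P = Q"
proof -
  have [simp]: "dim_row P = k" "dim_col P = k" "dim_row Q = k" "dim_col Q = k"
    using P Q by auto
  note [simp] = anisotropicD[OF H]
  have P': "ratmat_adjoint P * H = H * P" and Q': "ratmat_adjoint Q * H = H * Q"
    using HP HQ by (simp_all add: ratmat_adjoint_mult)
  have "H * P = H * Q"
    using PQ
  proof
    assume PQ: "P * Q = Q \<and> Q * P = P"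
    then have "H * P = H * Q * P"
      by (simp add: mat_mult_assoc)
    also have "\<dots> = ratmat_adjoint Q * (ratmat_adjoint P * H)"
      unfolding P' by (simp add: Q'[symmetric] mat_mult_assoc)
    also have "\<dots> = ratmat_adjoint (P * Q) * H"
      by (simp add: ratmat_adjoint_mult mat_mult_assoc)
    finally show ?thesis
      by (simp add: PQ Q')
  next
    assume PQ: "P * Q = P \<and> Q * P = Q"
    then have "H * P = H * P * Q"
      by (simp add: mat_mult_assoc)
    also have "\<dots> = ratmat_adjoint P * (ratmat_adjoint Q * H)"
      unfolding Q' by (simp add: P'[symmetric] mat_mult_assoc)
    also have "\<dots> = ratmat_adjoint (Q * P) * H"
      by (simp add: ratmat_adjoint_mult mat_mult_assoc)
    finally show ?thesis
      by (simp add: PQ Q')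
  qed
  then show ?thesis
    using anisotropic_mult_cancel[OF H P Q] by simp
qed

text \<open>\<open>A X\<close> and \<open>A Y\<close> are orthogonal projections with the same
  range, \<open>X A\<close> and \<open>Y A\<close> orthogonal projections with the same kernel. Both
  pairs agree, and then \<open>X = X A X = Y A X = Y A Y = Y\<close>.\<close>

lemma weighted_MP_unique:
  assumes M: "anisotropic m M" and N: "anisotropic n N" and A: "A \<in> carrier_mat m n"
    and X: "is_weighted_MP M N A X" and Y: "is_weighted_MP M N A Y"
  shows "X = Y"
proof -
  note [simp] = anisotropicD[OF M] anisotropicD[OF N]
  have dims [simp]: "dim_row A = m" "dim_col A = n" "dim_row X = n" "dim_col X = m"
    "dim_row Y = n" "dim_col Y = m"
    using A X Y by (auto simp: is_weighted_MP_def)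
  have XAX: "X * A * X = X" and YAY: "Y * A * Y = Y"
    using X Y by (simp_all add: is_weighted_MP_def)
  have AX: "ratmat_adjoint (M * (A * X)) = M * (A * X)" "ratmat_adjoint (M * (A * Y)) = M * (A * Y)"
    and XA: "ratmat_adjoint (N * (X * A)) = N * (X * A)" "ratmat_adjoint (N * (Y * A)) = N * (Y * A)"
    using X Y by (simp_all add: is_weighted_MP_def mat_mult_assoc)
  have AXA: "A * (X * (A * C)) = A * C" "A * (Y * (A * C)) = A * C" if "dim_row C = n" for C
    using X Y that by (simp_all add: is_weighted_MP_def flip: mat_mult_assoc)
  have AXA': "A * (X * A) = A" "A * (Y * A) = A"
    using X Y by (simp_all add: is_weighted_MP_def mat_mult_assoc)
  have AX_eq: "A * X = A * Y"
    by (rule selfadjoint_projections_eq[OF M]) (simp_all add: AX AXA mat_mult_assoc carrier_matI)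
  moreover have "X * A = Y * A"
    by (rule selfadjoint_projections_eq[OF N])
      (simp_all add: XA AXA' mat_mult_assoc carrier_matI)
  ultimately have "X = Y * A * X"
    using XAX by simp
  also have "\<dots> = Y * (A * X)"
    by (simp add: mat_mult_assoc)
  also have "\<dots> = Y"
    using AX_eq YAY by (simp add: mat_mult_assoc)
  finally show ?thesis .
qed

section \<open>Appending a column\<close>

text \<open>The mirror image of \<open>append_rows\<close>: a block matrix with empty lower blocks,
  so that products of the two come from block multiplication.\<close>

definition append_cols :: "'a::zero mat \<Rightarrow> 'a mat \<Rightarrow> 'a mat" (infixr \<open>@\<^sub>c\<close> 65) where
  "B @\<^sub>c a = four_block_mat B a (0\<^sub>m 0 (dim_col B)) (0\<^sub>m 0 (dim_col a))"

lemma dim_append_cols [simp]: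
  "dim_row (B @\<^sub>c a) = dim_row B" "dim_col (B @\<^sub>c a) = dim_col B + dim_col a"
  by (simp_all add: append_cols_def)

lemma dim_append_rows [simp]:
  "dim_row (T @\<^sub>r b) = dim_row T + dim_row b" "dim_col (T @\<^sub>r b) = dim_col T"
  by (simp_all add: append_rows_def)

lemma append_cols_mult_append_rows:
  fixes B a T b :: "'a::comm_ring_1 mat"
  assumes "dim_row a = dim_row B" "dim_col b = dim_col T" "dim_row T = dim_col B" "dim_row b = dim_col a"
  shows "(B @\<^sub>c a) * (T @\<^sub>r b) = B * T + a * b"
proof -
  have "(B @\<^sub>c a) * (T @\<^sub>r b) =
    four_block_mat (B * T + a * b) (B * 0\<^sub>m (dim_row T) 0 + a * 0\<^sub>m (dim_row b) 0)
      (0\<^sub>m 0 (dim_col B) * T + 0\<^sub>m 0 (dim_col a) * b)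
      (0\<^sub>m 0 (dim_col B) * 0\<^sub>m (dim_row T) 0 + 0\<^sub>m 0 (dim_col a) * 0\<^sub>m (dim_row b) 0)"
    unfolding append_cols_def append_rows_def
    by (rule mult_four_block_mat) (use assms in auto)
  also have "\<dots> = B * T + a * b"
    using assms by (intro eq_matI) (auto simp del: index_mult_mat(1))
  finally show ?thesis .
qed

lemma append_rows_mult_append_cols:
  fixes B a T b :: "'a::comm_ring_1 mat"
  assumes "dim_row a = dim_row B" "dim_col T = dim_row B" "dim_col b = dim_row B"
  shows "(T @\<^sub>r b) * (B @\<^sub>c a) = four_block_mat (T * B) (T * a) (b * B) (b * a)"
proof -
  have "(T @\<^sub>r b) * (B @\<^sub>c a) =
    four_block_mat (T * B + 0\<^sub>m (dim_row T) 0 * 0\<^sub>m 0 (dim_col B)) (T * a + 0\<^sub>m (dim_row T) 0 * 0\<^sub>m 0 (dim_col a))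
      (b * B + 0\<^sub>m (dim_row b) 0 * 0\<^sub>m 0 (dim_col B)) (b * a + 0\<^sub>m (dim_row b) 0 * 0\<^sub>m 0 (dim_col a))"
    unfolding append_cols_def append_rows_def
    by (rule mult_four_block_mat) (use assms in auto)
  also have "\<dots> = four_block_mat (T * B) (T * a) (b * B) (b * a)"
    using assms by (intro cong_four_block_mat eq_matI) (auto simp del: index_mult_mat(1))
  finally show ?thesis .
qed

lemma mult_append_cols:
  fixes P B a :: "'a::comm_ring_1 mat"
  assumes "dim_col P = dim_row B" "dim_row a = dim_row B"
  shows "P * (B @\<^sub>c a) = (P * B) @\<^sub>c (P * a)"
  using assms by (intro eq_matI) (auto simp: append_cols_def scalar_prod_def)

lemma append_rows_mult:
  fixes P T b :: "'a::comm_ring_1 mat"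
  assumes "dim_col T = dim_row P" "dim_col b = dim_row P"
  shows "(T @\<^sub>r b) * P = (T * P) @\<^sub>r (b * P)"
  using assms by (intro eq_matI) (auto simp: append_rows_def scalar_prod_def)

lemma four_block_mult_append_rows:
  fixes A B C D T b :: "'a::comm_ring_1 mat"
  assumes "A \<in> carrier_mat k1 l1" "B \<in> carrier_mat k1 l2" "C \<in> carrier_mat k2 l1" "D \<in> carrier_mat k2 l2"
    and "T \<in> carrier_mat l1 j" "b \<in> carrier_mat l2 j"
  shows "four_block_mat A B C D * (T @\<^sub>r b) = (A * T + B * b) @\<^sub>r (C * T + D * b)"
proof -
  have dims: "dim_row T = l1" "dim_row b = l2"
    using assms by auto
  have "four_block_mat A B C D * (T @\<^sub>r b) =
    four_block_mat (A * T + B * b) (A * 0\<^sub>m l1 0 + B * 0\<^sub>m l2 0)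
      (C * T + D * b) (C * 0\<^sub>m l1 0 + D * 0\<^sub>m l2 0)"
    unfolding append_rows_def dims
    by (rule mult_four_block_mat) (use assms in auto)
  also have "\<dots> = (A * T + B * b) @\<^sub>r (C * T + D * b)"
    unfolding append_rows_def
    using assms by (intro cong_four_block_mat eq_matI) (auto simp del: index_mult_mat(1))
  finally show ?thesis .
qed

lemma ratmat_adjoint_append_rows:
  assumes "dim_col b = dim_col T"
  shows "ratmat_adjoint (T @\<^sub>r b) = ratmat_adjoint T @\<^sub>c ratmat_adjoint b"
  using assms
  by (intro eq_matI) (auto simp: append_rows_def append_cols_def index_ratmat_adjoint)

text \<open>The bridge from \<open>1 x 1\<close> products to scalars, which can be inverted and
  pulled out; self-adjointness of the matrix becomes reality of the scalar.\<close>

lemma entry_one_by_one: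
  assumes "Q \<in> carrier_mat 1 1" and "w = Q $$ (0, 0)"
  shows "Q = w \<cdot>\<^sub>m 1\<^sub>m 1" and "ratmat_adjoint Q = Q \<Longrightarrow> fract_cnj w = w"
proof -
  show "Q = w \<cdot>\<^sub>m 1\<^sub>m 1"
    using assms by (intro eq_matI) auto
  show "fract_cnj w = w" if "ratmat_adjoint Q = Q"
    using index_ratmat_adjoint[of 0 Q 0] assms that by simp
qed

section \<open>The recursion for an appended column over the field of rational functions\<close>

locale appended_column =
  fixes m k :: nat and M N Ninv B X a l nn :: "complex poly fract mat"
  assumes M: "anisotropic m M" and N: "N \<in> carrier_mat k k"
    and Ninv: "Ninv \<in> carrier_mat k k" "N * Ninv = 1\<^sub>m k" "Ninv * N = 1\<^sub>m k"
    and B: "B \<in> carrier_mat m k" and a: "a \<in> carrier_mat m 1"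
    and l: "l \<in> carrier_mat k 1" and nn: "nn \<in> carrier_mat 1 1"
    and N': "anisotropic (Suc k) (four_block_mat N l (ratmat_adjoint l) nn)"
    and MP: "is_weighted_MP M N B X"
begin

lemma dims [simp]:
  "dim_row M = m" "dim_col M = m" "dim_row N = k" "dim_col N = k"
  "dim_row Ninv = k" "dim_col Ninv = k" "dim_row B = m" "dim_col B = k"
  "dim_row a = m" "dim_col a = 1" "dim_row l = k" "dim_col l = 1"
  "dim_row nn = 1" "dim_col nn = 1" "dim_row X = k" "dim_col X = m"
  using anisotropicD[OF M] N Ninv B a l nn MP by (auto simp: is_weighted_MP_def)

lemma adjoint_M [simp]: "ratmat_adjoint M = M"
  using anisotropicD[OF M] by simp

lemma adjoint_N [simp]: "ratmat_adjoint N = N" and adjoint_nn [simp]: "ratmat_adjoint nn = nn"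
proof -
  have eq: "four_block_mat N l (ratmat_adjoint l) nn =
      four_block_mat (ratmat_adjoint N) l (ratmat_adjoint l) (ratmat_adjoint nn)"
    using anisotropicD(2)[OF N', symmetric]
      ratmat_adjoint_four_block[of N k k l 1 "ratmat_adjoint l" 1 nn] N l nn
    by simp
  show "ratmat_adjoint N = N"
  proof (rule eq_matI)
    fix i j assume "i < dim_row N" "j < dim_col N"
    then show "ratmat_adjoint N $$ (i, j) = N $$ (i, j)"
      using arg_cong[OF eq, of "\<lambda>P. P $$ (i, j)"] by simp
  qed simp_all
  show "ratmat_adjoint nn = nn"
  proof (rule eq_matI)
    fix i j assume "i < dim_row nn" "j < dim_col nn"
    then show "ratmat_adjoint nn $$ (i, j) = nn $$ (i, j)"
      using arg_cong[OF eq, of "\<lambda>P. P $$ (i + k, j + k)"] by simp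
  qed simp_all
qed

lemma N_Ninv: "N * (Ninv * C) = C" "Ninv * (N * C) = C" if "dim_row C = k"
  using Ninv that by (simp_all flip: mat_mult_assoc)

lemma adjoint_Ninv [simp]: "ratmat_adjoint Ninv = Ninv"
proof -
  have "ratmat_adjoint Ninv = ratmat_adjoint Ninv * (N * Ninv)"
    by (simp add: Ninv)
  also have "\<dots> = ratmat_adjoint (N * Ninv) * Ninv"
    by (simp add: ratmat_adjoint_mult mat_mult_assoc)
  finally show ?thesis
    by (simp add: Ninv)
qed

lemma BXB: "B * (X * B) = B" and XBX: "X * (B * X) = X"
  and adjoint_MBX: "ratmat_adjoint X * (ratmat_adjoint B * M) = M * (B * X)"
  and adjoint_NXB: "ratmat_adjoint B * (ratmat_adjoint X * N) = N * (X * B)"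
  using MP by (simp_all add: is_weighted_MP_def mat_mult_assoc ratmat_adjoint_mult)

lemma BXB': "dim_row C = k \<Longrightarrow> B * (X * (B * C)) = B * C"
  using BXB by (simp flip: mat_mult_assoc)

lemma XBX': "dim_row C = m \<Longrightarrow> X * (B * (X * C)) = X * C"
  using XBX by (simp flip: mat_mult_assoc)

lemma adjoint_MBX': "dim_row C = m \<Longrightarrow>
    ratmat_adjoint X * (ratmat_adjoint B * (M * C)) = M * (B * (X * C))"
  using adjoint_MBX by (simp flip: mat_mult_assoc)

lemma adjoint_NXB': "dim_row C = k \<Longrightarrow>
    ratmat_adjoint B * (ratmat_adjoint X * (N * C)) = N * (X * (B * C))"
  using adjoint_NXB by (simp flip: mat_mult_assoc)

text \<open>\<open>X B\<close> is self-adjoint for \<open>N\<close>; multiplying this by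
  \<open>Ninv\<close> on both sides moves the adjoint projection across \<open>Ninv\<close>.\<close>

lemma Ninv_adjoint_XB: "dim_row C = k \<Longrightarrow>
    Ninv * (ratmat_adjoint B * (ratmat_adjoint X * C)) = X * (B * (Ninv * C))"
  using arg_cong[OF adjoint_NXB'[of "Ninv * C"], of "\<lambda>P. Ninv * P"] by (simp add: N_Ninv)

lemma adjoint_BXB: "dim_row C = k \<Longrightarrow>
    ratmat_adjoint X * (ratmat_adjoint B * (ratmat_adjoint X * C)) = ratmat_adjoint X * C"
  using arg_cong[OF XBX, of ratmat_adjoint] by (simp add: ratmat_adjoint_mult flip: mat_mult_assoc)

text \<open>Oriented so that adjoint projections move across \<open>M\<close>, \<open>N\<close> and
  \<open>Ninv\<close>, turning into plain projections, after which adjacent projections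
  collapse.\<close>

lemmas MP_simps = adjoint_BXB N_Ninv BXB XBX adjoint_MBX adjoint_NXB BXB' XBX' adjoint_MBX' adjoint_NXB'
  Ninv_adjoint_XB

text \<open>Since \<open>B X\<close> is the \<open>M\<close>-orthogonal projection onto the range of
  \<open>B\<close>, \<open>c\<close> is the component of \<open>a\<close> orthogonal to that range.
  Likewise \<open>p\<close> is the \<open>N\<close>-orthogonal projection of \<open>Ninv l\<close>
  onto \<open>ker B\<close>. The pair \<open>(g, -e)\<close> is the image of
  \<open>(d + p, -1)\<close> under the bordered matrix.\<close>

definition "d = X * a"
definition "c = a - B * d"
definition "p = Ninv * l - X * (B * (Ninv * l))"
definition "g = N * d - ratmat_adjoint B * (ratmat_adjoint X * l)"
definition "e = nn - ratmat_adjoint l * (d + p)"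

lemma dims' [simp]:
  "dim_row d = k" "dim_col d = 1" "dim_row c = m" "dim_col c = 1" "dim_row p = k" "dim_col p = 1"
  "dim_row g = k" "dim_col g = 1" "dim_row e = 1" "dim_col e = 1"
  by (simp_all add: d_def c_def p_def g_def e_def)

lemma X_c: "X * c = 0\<^sub>m k 1"
  by (simp add: c_def d_def mat_algebra MP_simps)

text \<open>\<open>N p = l - (X B)^* l\<close>, so \<open>l\<close> cancels. The rule for
  \<open>N X B\<close> is reversed here: with the adjoints moved to the left, \<open>N\<close> meets
  \<open>Ninv\<close> and disappears.\<close>

lemma N_d_p: "N * (d + p) - l = g"
  by (rule eq_matI)
    (simp_all add: g_def d_def p_def mat_algebra MP_simps flip: adjoint_NXB' del: index_mult_mat(1))

text \<open>The part common to both cases: the defining equations of the new inverse become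
  conditions on \<open>b\<close> alone. The first four conditions after the carrier one concern the
  projection \<open>B X + c b\<close> and its products with \<open>[B a]\<close> and the new
  inverse; the last three say that the block matrix belonging to the weight \<open>N\<close> is
  self-adjoint.\<close>

lemma weighted_MP_append_column:
  assumes b: "b \<in> carrier_mat 1 m"
    and cb: "ratmat_adjoint (M * (c * b)) = M * (c * b)"
    and cbB: "c * (b * B) = 0\<^sub>m m k" and cba: "c * (b * a) = c"
    and bP: "b * (B * X) + b * (c * b) = b"
    and h11: "ratmat_adjoint (g * (b * B)) = g * (b * B)"
    and h12: "ratmat_adjoint (N * d - g * (b * a)) = ratmat_adjoint l * (X * B) + e * (b * B)"
    and h22: "ratmat_adjoint (ratmat_adjoint l * d + e * (b * a)) = ratmat_adjoint l * d + e * (b * a)"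
  shows "is_weighted_MP M (four_block_mat N l (ratmat_adjoint l) nn) (B @\<^sub>c a)
    ((X - (d + p) * b) @\<^sub>r b)"
proof -
  define T where "T = X - (d + p) * b"
  define P where "P = B * X + c * b"
  have [simp]: "dim_row b = 1" "dim_col b = m" "dim_row T = k" "dim_col T = m"
      "dim_row P = m" "dim_col P = m"
    using b by (simp_all add: T_def P_def)
  have X_c': "X * (c * C) = 0\<^sub>m k (dim_col C)" if "dim_row C = 1" for C
    using X_c that by (simp flip: mat_mult_assoc)
  \<comment> \<open>\<open>B p = 0\<close>, so the correction contributes
    \<open>(a - B d) b = c b\<close>.\<close>
  have AX: "(B @\<^sub>c a) * (T @\<^sub>r b) = P"
    by (simp add: append_cols_mult_append_rows T_def P_def c_def p_def mat_algebra MP_simps)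
      (rule eq_matI; simp add: algebra_simps del: index_mult_mat(1))
  have "P * B = B"
    using cbB by (simp add: P_def mat_algebra MP_simps)
  moreover have "P * a = a"
    using cba by (simp add: P_def mat_algebra flip: d_def)
      (rule eq_matI; simp add: c_def algebra_simps del: index_mult_mat(1))
  ultimately have PA: "P * (B @\<^sub>c a) = B @\<^sub>c a"
    by (simp add: mult_append_cols)
  have bP': "b * P = b"
    using bP by (simp add: P_def mat_algebra)
  have "X * P = X"
    by (simp add: P_def mat_algebra MP_simps X_c')
  then have "T * P = T"
    using bP' by (simp add: T_def mat_algebra)
  with bP' have XP: "(T @\<^sub>r b) * P = T @\<^sub>r b"
    by (simp add: append_rows_mult)
  have MP': "ratmat_adjoint (M * P) = M * P"
    using cb by (simp add: P_def mat_algebra ratmat_adjoint_algebra MP_simps)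
  have XA: "(T @\<^sub>r b) * (B @\<^sub>c a) = four_block_mat (T * B) (T * a) (b * B) (b * a)"
    by (rule append_rows_mult_append_cols) simp_all
  \<comment> \<open>The two terms containing \<open>b\<close> combine to
    \<open>-(N (d + p) - l) b B\<close>, which is why \<open>g\<close> appears; the next block works
    in the same way, and the lower blocks produce \<open>e\<close>.\<close>
  have N11: "N * (T * B) + l * (b * B) = N * (X * B) - g * (b * B)"
    by (rule eq_matI)
      (simp_all add: T_def mat_algebra N_d_p[symmetric] del: index_mult_mat(1))
  have N12: "N * (T * a) + l * (b * a) = N * d - g * (b * a)"
    by (rule eq_matI)
      (simp_all add: T_def mat_algebra N_d_p[symmetric] del: index_mult_mat(1) flip: d_def)
  have N21: "ratmat_adjoint l * (T * B) + nn * (b * B) = ratmat_adjoint l * (X * B) + e * (b * B)"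
    by (rule eq_matI)
      (simp_all add: T_def mat_algebra e_def del: index_mult_mat(1))
  have N22: "ratmat_adjoint l * (T * a) + nn * (b * a) = ratmat_adjoint l * d + e * (b * a)"
    by (rule eq_matI)
      (simp_all add: T_def mat_algebra e_def del: index_mult_mat(1) flip: d_def)
  have "four_block_mat N l (ratmat_adjoint l) nn * four_block_mat (T * B) (T * a) (b * B) (b * a) =
    four_block_mat (N * (X * B) - g * (b * B)) (N * d - g * (b * a))
      (ratmat_adjoint l * (X * B) + e * (b * B)) (ratmat_adjoint l * d + e * (b * a))"
    unfolding N11[symmetric] N12[symmetric] N21[symmetric] N22[symmetric]
    by (rule mult_four_block_mat[of _ k k _ 1 _ 1 _ _ k _ 1]) (simp_all add: carrier_matI)
  moreover have "ratmat_adjoint \<dots> = \<dots>"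
  proof (subst ratmat_adjoint_four_block[of _ k k _ 1 _ 1])
    \<comment> \<open>The two off-diagonal blocks are adjoint to each other, so \<open>h12\<close>
      and its adjoint settle both.\<close>
    have "N * d - g * (b * a) = ratmat_adjoint (ratmat_adjoint l * (X * B) + e * (b * B))"
      by (simp flip: h12)
    then show "four_block_mat
       (ratmat_adjoint (N * (X * B) - g * (b * B)))
       (ratmat_adjoint (ratmat_adjoint l * (X * B) + e * (b * B)))
       (ratmat_adjoint (N * d - g * (b * a)))
       (ratmat_adjoint (ratmat_adjoint l * d + e * (b * a))) =
      four_block_mat (N * (X * B) - g * (b * B)) (N * d - g * (b * a))
       (ratmat_adjoint l * (X * B) + e * (b * B))
       (ratmat_adjoint l * d + e * (b * a))"
      by (intro cong_four_block_mat)
        (simp_all add: h22 h12 ratmat_adjoint_minus h11 ratmat_adjoint_mult[of N] ratmat_adjoint_mult[of X]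
          mat_mult_assoc MP_simps)
  qed (simp_all add: carrier_matI)
  ultimately have NXA: "ratmat_adjoint (four_block_mat N l (ratmat_adjoint l) nn * ((T @\<^sub>r b) * (B @\<^sub>c a))) =
      four_block_mat N l (ratmat_adjoint l) nn * ((T @\<^sub>r b) * (B @\<^sub>c a))"
    by (simp add: XA)
  show ?thesis
    unfolding is_weighted_MP_def T_def[symmetric]
    using AX PA XP MP' NXA by (auto simp: mat_mult_assoc intro!: carrier_matI)
qed

text \<open>Here \<open>b B = 0\<close> and \<open>b c = 1\<close>, so \<open>b a = 1\<close>
  because \<open>a = c + B d\<close>. All conditions on \<open>b\<close> then collapse.\<close>

lemma weighted_MP_append_independent_column:
  assumes "c \<noteq> 0\<^sub>m m 1"
    and w_def: "w = (ratmat_adjoint c * M * c) $$ (0, 0)"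
    and b_def: "b = inverse w \<cdot>\<^sub>m (ratmat_adjoint c * M)"
  shows "is_weighted_MP M (four_block_mat N l (ratmat_adjoint l) nn) (B @\<^sub>c a)
      ((X - (d + p) * b) @\<^sub>r b)"
    and "w \<noteq> 0" and "fract_cnj w = w"
proof -
  have w: "ratmat_adjoint c * (M * c) = w \<cdot>\<^sub>m 1\<^sub>m 1"
    using entry_one_by_one(1)[OF _ w_def] by (simp add: carrier_matI mat_mult_assoc)
  show cnj_w: "fract_cnj w = w"
    by (rule entry_one_by_one(2)[OF _ w_def]) (simp_all add: carrier_matI ratmat_adjoint_mult mat_mult_assoc)
  show w0: "w \<noteq> 0"
  proof
    assume "w = 0"
    then have "ratmat_adjoint c * M * c = 0\<^sub>m 1 1"
      using w by (simp add: mat_mult_assoc) (intro eq_matI; simp)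
    moreover have "c \<in> carrier_mat m 1"
      by (simp add: carrier_matI)
    ultimately show False
      using M assms(1) by (auto simp: anisotropic_def)
  qed
  \<comment> \<open>This is the orthogonality of \<open>c\<close> to the range of \<open>B\<close>,
    from \<open>(B X)^* M = M B X\<close>.\<close>
  have cMB: "ratmat_adjoint c * (M * B) = 0\<^sub>m 1 k"
    by (simp add: c_def d_def ratmat_adjoint_algebra mat_algebra MP_simps)
  have cMB': "ratmat_adjoint c * (M * (B * C)) = 0\<^sub>m 1 (dim_col C)" if "dim_row C = k" for C
    using cMB that by (simp flip: mat_mult_assoc)
  have [simp]: "dim_row b = 1" "dim_col b = m"
    by (simp_all add: b_def)
  have bB: "b * B = 0\<^sub>m 1 k"
    by (simp add: b_def mat_algebra cMB)
  have bc: "b * c = 1\<^sub>m 1"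
    using w0 by (simp add: b_def mat_algebra w)
  have "a = c + B * d"
    by (rule eq_matI) (simp_all add: c_def del: index_mult_mat(1))
  then have "b * a = b * c + b * (B * d)"
    by (metis mat_mult_add_left dims dims' index_mult_mat(2,3) \<open>dim_col b = m\<close>)
  also have "b * (B * d) = b * B * d"
    by (simp add: mat_mult_assoc)
  finally have ba: "b * a = 1\<^sub>m 1"
    by (simp add: bB bc)
  show "is_weighted_MP M (four_block_mat N l (ratmat_adjoint l) nn) (B @\<^sub>c a)
      ((X - (d + p) * b) @\<^sub>r b)"
  proof (rule weighted_MP_append_column)
    show "b \<in> carrier_mat 1 m"
      by (simp add: carrier_matI)
    show "ratmat_adjoint (M * (c * b)) = M * (c * b)"
      by (simp add: b_def ratmat_adjoint_algebra mat_algebra fract_cnj_inverse cnj_w)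
    have "b * (B * X) = b * B * X" "b * (c * b) = b * c * b"
      by (simp_all add: mat_mult_assoc)
    then show "b * (B * X) + b * (c * b) = b"
      by (simp add: bB bc)
    show "ratmat_adjoint (N * d - g * (b * a)) = ratmat_adjoint l * (X * B) + e * (b * B)"
      by (simp add: bB ba)
        (rule eq_matI; simp add: g_def mat_algebra ratmat_adjoint_algebra del: index_mult_mat(1))
    have "ratmat_adjoint l * d + e * (b * a) = nn - ratmat_adjoint l * p"
      by (simp add: ba) (rule eq_matI; simp add: e_def mat_algebra del: index_mult_mat(1))
    \<comment> \<open>\<open>l^* p\<close> is real because both \<open>Ninv\<close> and
      \<open>X B Ninv\<close> are self-adjoint.\<close>
    moreover have "ratmat_adjoint \<dots> = \<dots>"
      by (simp add: p_def mat_algebra ratmat_adjoint_algebra MP_simps)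
    ultimately show "ratmat_adjoint (ratmat_adjoint l * d + e * (b * a)) = ratmat_adjoint l * d + e * (b * a)"
      by simp
  qed (simp_all add: bB ba)
qed

lemma d_simps:
  "X * (B * d) = d"
  "dim_row C = k \<Longrightarrow> ratmat_adjoint d * (ratmat_adjoint B * (ratmat_adjoint X * C)) = ratmat_adjoint d * C"
  by (simp_all add: d_def ratmat_adjoint_mult mat_mult_assoc MP_simps)

text \<open>The left side is what the geometry produces, the right side what the algorithm
  evaluates. They agree because \<open>(X B) d = d\<close> removes the projection from
  \<open>d^* g\<close>.\<close>

lemma schur_complement:
  "e + ratmat_adjoint d * g = nn + ratmat_adjoint d * N * d - ratmat_adjoint d * l
    - ratmat_adjoint l * d - ratmat_adjoint l * p"
  by (rule eq_matI)
    (simp_all add: e_def g_def mat_algebra d_simps del: index_mult_mat(1))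

text \<open>The value of the bordered form at \<open>v = (d + p, -1)\<close> is
  \<open>(d + p)^* g + e\<close>, and the last entry of \<open>v\<close> shows that \<open>v\<close>
  is nonzero.\<close>

lemma schur_complement_nonzero: "e + ratmat_adjoint d * g \<noteq> 0\<^sub>m 1 1"
proof -
  define u where "u = (- 1 :: complex poly fract) \<cdot>\<^sub>m 1\<^sub>m 1"
  define v where "v = (d + p) @\<^sub>r u"
  have [simp]: "dim_row u = 1" "dim_col u = 1" "dim_row v = Suc k" "dim_col v = 1"
    by (simp_all add: u_def v_def)
  \<comment> \<open>\<open>g = (X B)^* (N d - l)\<close> while \<open>B p = 0\<close>: the vector
    \<open>p\<close> lies in \<open>ker B\<close>, and \<open>g\<close> annihilates that
    kernel.\<close>
  have p_g: "ratmat_adjoint p * g = 0\<^sub>m 1 1"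
    by (simp add: p_def g_def mat_algebra ratmat_adjoint_algebra MP_simps d_simps)
  have g: "N * (d + p) + l * u = g" and e: "ratmat_adjoint l * (d + p) + nn * u = (- 1) \<cdot>\<^sub>m e"
    by (rule eq_matI; simp add: u_def e_def mat_algebra N_d_p[symmetric] del: index_mult_mat(1))+
  have "four_block_mat N l (ratmat_adjoint l) nn * v = g @\<^sub>r ((- 1) \<cdot>\<^sub>m e)"
    unfolding v_def g[symmetric] e[symmetric]
    by (rule four_block_mult_append_rows[of _ k k _ 1 _ 1 _ _ 1]) (simp_all add: carrier_matI)
  then have "ratmat_adjoint v * four_block_mat N l (ratmat_adjoint l) nn * v =
      (ratmat_adjoint (d + p) @\<^sub>c ratmat_adjoint u) * (g @\<^sub>r ((- 1) \<cdot>\<^sub>m e))"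
    by (simp add: mat_mult_assoc) (simp add: v_def ratmat_adjoint_append_rows)
  also have "\<dots> = e + ratmat_adjoint d * g"
    by (simp add: append_cols_mult_append_rows ratmat_adjoint_algebra mat_algebra p_g u_def fract_cnj_uminus)
      (rule eq_matI; simp del: index_mult_mat(1))
  finally have eq: "ratmat_adjoint v * four_block_mat N l (ratmat_adjoint l) nn * v = e + ratmat_adjoint d * g" .
  have "v $$ (k, 0) = - 1"
    by (simp add: v_def append_rows_def u_def)
  then have "v \<noteq> 0\<^sub>m (Suc k) 1"
    by auto
  moreover have "v \<in> carrier_mat (Suc k) 1"
    by (simp add: carrier_matI)
  ultimately show ?thesis
    using N' eq by (auto simp: anisotropic_def)
qed

text \<open>From \<open>X B X = X\<close> one gets \<open>g^* X = (d^* N - l^*\<close>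
  \<open>) X\<close>, so \<open>b\<close> is the functional \<open>g^* / w\<close> composed with
  \<open>X\<close>. Hence \<open>b B = g^* / w\<close> and \<open>b a = g^* d / w\<close>, and the
  blocks become visibly symmetric in \<open>g\<close>.\<close>

lemma weighted_MP_append_dependent_column:
  assumes c: "c = 0\<^sub>m m 1"
    and w_def: "w = (nn + ratmat_adjoint d * N * d - ratmat_adjoint d * l
      - ratmat_adjoint l * d - ratmat_adjoint l * p) $$ (0, 0)"
    and b_def: "b = inverse w \<cdot>\<^sub>m ((ratmat_adjoint d * N - ratmat_adjoint l) * X)"
  shows "is_weighted_MP M (four_block_mat N l (ratmat_adjoint l) nn) (B @\<^sub>c a)
      ((X - (d + p) * b) @\<^sub>r b)"
    and "w \<noteq> 0" and "fract_cnj w = w"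
proof -
  have w: "e + ratmat_adjoint d * g = w \<cdot>\<^sub>m 1\<^sub>m 1"
    using entry_one_by_one(1)[OF _ w_def] by (simp add: carrier_matI schur_complement)
  show cnj_w: "fract_cnj w = w"
  proof (rule entry_one_by_one(2)[OF _ w_def])
    show "ratmat_adjoint (nn + ratmat_adjoint d * N * d - ratmat_adjoint d * l
        - ratmat_adjoint l * d - ratmat_adjoint l * p) =
      nn + ratmat_adjoint d * N * d - ratmat_adjoint d * l - ratmat_adjoint l * d - ratmat_adjoint l * p"
      by (simp add: p_def mat_algebra ratmat_adjoint_algebra MP_simps)
        (rule eq_matI; simp del: index_mult_mat(1))
  qed (simp add: carrier_matI)
  show w0: "w \<noteq> 0"
  proof
    assume "w = 0"
    then have "e + ratmat_adjoint d * g = 0\<^sub>m 1 1"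
      unfolding w by (intro eq_matI) simp_all
    then show False
      using schur_complement_nonzero by simp
  qed
  \<comment> \<open>Eliminating \<open>e\<close> through the Schur complement exposes the symmetry:
    its factor \<open>w\<close> cancels the denominator of \<open>b\<close>, and the remainder
    matches the terms coming from \<open>g b\<close>.\<close>
  have e: "e = w \<cdot>\<^sub>m 1\<^sub>m 1 - ratmat_adjoint d * g"
    unfolding w[symmetric] by (rule eq_matI) (simp_all del: index_mult_mat(1))
  have [simp]: "dim_row b = 1" "dim_col b = m"
    by (simp_all add: b_def)
  have adj_g: "ratmat_adjoint g = ratmat_adjoint d * N - ratmat_adjoint l * (X * B)"
    by (simp add: g_def ratmat_adjoint_algebra mat_algebra)
  have "ratmat_adjoint d * (N * (X * B)) = ratmat_adjoint d * N"
    by (simp add: d_simps flip: adjoint_NXB)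
  then have bB: "b * B = inverse w \<cdot>\<^sub>m ratmat_adjoint g"
    by (simp add: b_def adj_g mat_algebra)
  have ba: "b * a = inverse w \<cdot>\<^sub>m (ratmat_adjoint g * d)"
    by (simp add: b_def adj_g mat_algebra d_simps flip: d_def)
  have gd: "ratmat_adjoint l * d + ratmat_adjoint g * d = ratmat_adjoint d * (N * d)"
    and gl: "ratmat_adjoint l * (X * B) + ratmat_adjoint g = ratmat_adjoint d * N"
    by (rule eq_matI; simp add: adj_g mat_algebra d_simps del: index_mult_mat(1))+
  show "is_weighted_MP M (four_block_mat N l (ratmat_adjoint l) nn) (B @\<^sub>c a)
      ((X - (d + p) * b) @\<^sub>r b)"
  proof (rule weighted_MP_append_column)
    show "b \<in> carrier_mat 1 m"
      by (simp add: carrier_matI)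
    show "b * (B * X) + b * (c * b) = b"
      by (simp add: c b_def mat_algebra MP_simps)
    show "ratmat_adjoint (g * (b * B)) = g * (b * B)"
      by (simp add: bB mat_algebra ratmat_adjoint_algebra fract_cnj_inverse cnj_w)
    have "ratmat_adjoint l * (X * B) + e * (b * B) =
        ratmat_adjoint l * (X * B) + ratmat_adjoint g
          - inverse w \<cdot>\<^sub>m (ratmat_adjoint d * (g * ratmat_adjoint g))"
      by (rule eq_matI) (use w0 in \<open>simp_all add: e bB mat_algebra del: index_mult_mat(1)\<close>)
    then show "ratmat_adjoint (N * d - g * (b * a)) = ratmat_adjoint l * (X * B) + e * (b * B)"
      unfolding gl
      by (simp add: ba mat_algebra ratmat_adjoint_algebra fract_cnj_inverse cnj_w)
    have "ratmat_adjoint l * d + e * (b * a) =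
        ratmat_adjoint l * d + ratmat_adjoint g * d
          - inverse w \<cdot>\<^sub>m (ratmat_adjoint d * (g * (ratmat_adjoint g * d)))"
      by (rule eq_matI) (use w0 in \<open>simp_all add: e ba mat_algebra del: index_mult_mat(1)\<close>)
    then show "ratmat_adjoint (ratmat_adjoint l * d + e * (b * a)) = ratmat_adjoint l * d + e * (b * a)"
      unfolding gd
      by (simp add: mat_algebra ratmat_adjoint_algebra fract_cnj_inverse cnj_w)
  qed (simp_all add: c)
qed

end

section \<open>Positive definiteness\<close>

lemma index_quadratic_form:
  assumes "v \<in> carrier_mat n 1" "H \<in> carrier_mat n n"
  shows "(ratmat_adjoint v * (H * v)) $$ (0, 0) =
    (\<Sum>i<n. fract_cnj (v $$ (i, 0)) * (\<Sum>j<n. H $$ (i, j) * v $$ (j, 0)))"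
  using assms by (auto simp: scalar_prod_def index_ratmat_adjoint lessThan_atLeast0 intro!: sum.cong)

text \<open>As a double sum the form can be padded with zeros, cleared of denominators and evaluated
  at a point.\<close>

lemma quadratic_form_eq_0_iff:
  assumes "v \<in> carrier_mat n 1" "H \<in> carrier_mat n n"
  shows "ratmat_adjoint v * H * v = 0\<^sub>m 1 1 \<longleftrightarrow>
    (\<Sum>i<n. fract_cnj (v $$ (i, 0)) * (\<Sum>j<n. H $$ (i, j) * v $$ (j, 0))) = 0"
proof -
  have "Q = 0\<^sub>m 1 1 \<longleftrightarrow> Q $$ (0, 0) = 0" if "Q \<in> carrier_mat 1 1" for Q :: "complex poly fract mat"
    using that by (auto intro!: eq_matI)
  from this[of "ratmat_adjoint v * H * v"] assms show ?thesis
    by (simp add: index_quadratic_form del: index_mult_mat(1))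
qed

lemma anisotropic_leading_submat:
  assumes H: "anisotropic n H" and k: "k \<le> n"
  shows "anisotropic k (leading_submat k H)"
  unfolding anisotropic_def
proof (intro conjI ballI impI)
  show "leading_submat k H \<in> carrier_mat k k"
    by (simp add: leading_submat_def)
  show "ratmat_adjoint (leading_submat k H) = leading_submat k H"
  proof (rule eq_matI)
    fix i j assume "i < dim_row (leading_submat k H)" "j < dim_col (leading_submat k H)"
    then show "ratmat_adjoint (leading_submat k H) $$ (i, j) = leading_submat k H $$ (i, j)"
      using k index_ratmat_adjoint[of i H j] anisotropicD[OF H]
      by (simp add: leading_submat_def index_ratmat_adjoint)
  qed (simp_all add: leading_submat_def)
  fix v :: "complex poly fract mat"
  assume v: "v \<in> carrier_mat k 1" and v0: "v \<noteq> 0\<^sub>m k 1"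
  \<comment> \<open>Padding by zeros keeps the value of the form and the vector nonzero.\<close>
  define w where "w = mat n 1 (\<lambda>(i, _). if i < k then v $$ (i, 0) else 0)"
  have w: "w \<in> carrier_mat n 1"
    by (simp add: w_def)
  obtain i where "i < k" "v $$ (i, 0) \<noteq> 0"
    using v v0 by (metis (no_types, lifting) carrier_matD eq_matI index_zero_mat less_one)
  then have "w $$ (i, 0) \<noteq> 0" "i < n"
    using k by (simp_all add: w_def)
  then have "w \<noteq> 0\<^sub>m n 1"
    by auto
  with H w have "ratmat_adjoint w * H * w \<noteq> 0\<^sub>m 1 1"
    by (simp add: anisotropic_def)
  moreover have "(\<Sum>i<n. fract_cnj (w $$ (i, 0)) * (\<Sum>j<n. H $$ (i, j) * w $$ (j, 0))) =
      (\<Sum>i<k. fract_cnj (v $$ (i, 0)) * (\<Sum>j<k. leading_submat k H $$ (i, j) * v $$ (j, 0)))"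
    using k
    by (intro sum.mono_neutral_cong_right arg_cong2[where f = times])
      (auto simp: w_def leading_submat_def intro!: sum.mono_neutral_cong_right)
  ultimately show "ratmat_adjoint v * leading_submat k H * v \<noteq> 0\<^sub>m 1 1"
    using quadratic_form_eq_0_iff[OF w, of H] quadratic_form_eq_0_iff[OF v, of "leading_submat k H"]
      anisotropicD[OF H]
    by (simp add: leading_submat_def)
qed

section \<open>Clearing denominators and evaluation at real points\<close>

lemma to_fract_sum: "to_fract (sum f S) = (\<Sum>i\<in>S. to_fract (f i))"
  by (induction S rule: infinite_finite_induct) auto

lemma common_denominator:
  assumes "finite (S :: 'a::idom fract set)"
  obtains c where "c \<noteq> 0" and "\<And>x. x \<in> S \<Longrightarrow> \<exists>p. to_fract c * x = to_fract p"
  using assms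
proof (induction S arbitrary: thesis)
  case empty
  show ?case
    by (rule empty.prems[of 1]) auto
next
  case (insert x S)
  obtain c where c: "c \<noteq> 0" "\<And>x. x \<in> S \<Longrightarrow> \<exists>p. to_fract c * x = to_fract p"
    using insert.IH by blast
  obtain a b where ab: "x = Fract a b" "b \<noteq> 0"
    by (cases x) auto
  show ?case
  proof (rule insert.prems)
    show "b * c \<noteq> 0"
      using c ab by simp
    fix y assume "y \<in> insert x S"
    then show "\<exists>p. to_fract (b * c) * y = to_fract p"
    proof
      assume "y = x"
      then have "to_fract (b * c) * y = to_fract (c * a)"
        using ab by (simp add: to_fract_def eq_fract mult_ac)
      then show ?thesis ..
    next
      assume "y \<in> S"
      then obtain p where "to_fract c * y = to_fract p"
        using c by blast
      then have "to_fract (b * c) * y = to_fract (b * p)"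
        by (simp add: mult.assoc)
      then show ?thesis ..
    qed
  qed
qed

lemma has_value_at_to_fract:
  assumes "has_value_at (to_fract p) z w"
  shows "w = poly p z"
proof -
  obtain a b where ab: "poly b z \<noteq> 0" "to_fract p = Fract a b" "w = poly a z / poly b z"
    using assms by (auto simp: has_value_at_def)
  then have "a = p * b"
    by (cases "b = 0") (auto simp: to_fract_def eq_fract)
  with ab show ?thesis
    by simp
qed

text \<open>The point where \<open>s\<close> is treated as real: conjugating coefficients agrees
  with conjugating values only because the argument is real.\<close>

lemma poly_cnj_poly_of_real: "poly (map_poly cnj p) (of_real t) = cnj (poly p (of_real t))"
  by (induction p) (auto simp: map_poly_pCons)

text \<open>A nonzero isotropic vector, scaled to polynomial entries \<open>u\<close>, gives a
  polynomial identity \<open>u^* P u = 0\<close>. Evaluated at a suitable point of the interval, it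
  contradicts positivity there.\<close>

lemma pos_def_imp_anisotropic:
  fixes P :: "complex poly mat"
  assumes "pos_def_ratmat n (ratmat P)"
  shows "anisotropic n (ratmat P)"
  unfolding anisotropic_def
proof (intro conjI ballI impI)
  show P: "ratmat P \<in> carrier_mat n n" and "ratmat_adjoint (ratmat P) = ratmat P"
    using assms by (auto simp: pos_def_ratmat_def)
  fix v :: "complex poly fract mat"
  assume v: "v \<in> carrier_mat n 1" and v0: "v \<noteq> 0\<^sub>m n 1"
  obtain c where c: "c \<noteq> 0"
    and "\<And>x. x \<in> (\<lambda>i. v $$ (i, 0)) ` {..<n} \<Longrightarrow> \<exists>p. to_fract c * x = to_fract p"
    by (rule common_denominator[of "(\<lambda>i. v $$ (i, 0)) ` {..<n}"]) simp_all
  then have "\<exists>p. to_fract c * v $$ (i, 0) = to_fract p" if "i < n" for i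
    using that by simp
  then obtain u where u: "\<And>i. i < n \<Longrightarrow> to_fract c * v $$ (i, 0) = to_fract (u i)"
    by metis
  obtain i0 where i0: "i0 < n" "v $$ (i0, 0) \<noteq> 0"
    using v v0 by (metis (no_types, lifting) carrier_matD eq_matI index_zero_mat less_one)
  then have "u i0 \<noteq> 0"
    using u[of i0] c by auto
  show "ratmat_adjoint v * ratmat P * v \<noteq> 0\<^sub>m 1 1"
  proof
    assume "ratmat_adjoint v * ratmat P * v = 0\<^sub>m 1 1"
    \<comment> \<open>The right copy of \<open>v\<close> is scaled by \<open>c\<close>; the left
      copy enters conjugated and takes the conjugate of \<open>c\<close>.\<close>
    then have "0 = to_fract (map_poly cnj c) * (\<Sum>i<n. fract_cnj (v $$ (i, 0)) * (\<Sum>j<n. ratmat P $$ (i, j) * v $$ (j, 0))) * to_fract c"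
      using quadratic_form_eq_0_iff[OF v P] by simp
    also have "\<dots> = (\<Sum>i<n. fract_cnj (to_fract c * v $$ (i, 0)) * (\<Sum>j<n. ratmat P $$ (i, j) * (to_fract c * v $$ (j, 0))))"
      by (simp only: sum_distrib_left sum_distrib_right fract_cnj_mult fract_cnj_to_fract mult_ac)
    also have "\<dots> = to_fract (\<Sum>i<n. map_poly cnj (u i) * (\<Sum>j<n. P $$ (i, j) * u j))"
      using P by (auto simp: u fract_cnj_to_fract to_fract_sum intro!: sum.cong)
    finally have 0: "(\<Sum>i<n. map_poly cnj (u i) * (\<Sum>j<n. P $$ (i, j) * u j)) = 0"
      by (rule to_fract_eq_0_iff[THEN iffD1, OF sym])
    obtain a b :: real where "a < b"
      and ab: "\<And>t. a < t \<Longrightarrow> t < b \<Longrightarrow> \<exists>C. pos_def_mat n C \<and>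
        (\<forall>i<n. \<forall>j<n. has_value_at (ratmat P $$ (i, j)) (of_real t) (C $$ (i, j)))"
      using assms by (auto simp: pos_def_ratmat_def)
    \<comment> \<open>The nonzero entry \<open>u i0\<close> has finitely many roots, so some point
      of the interval keeps the evaluated vector nonzero.\<close>
    have "infinite (complex_of_real ` {a<..<b})"
      using \<open>a < b\<close> by (simp add: finite_image_iff inj_on_def infinite_Ioo)
    then have "\<not> complex_of_real ` {a<..<b} \<subseteq> {x. poly (u i0) x = 0}"
      using poly_roots_finite[OF \<open>u i0 \<noteq> 0\<close>] finite_subset by blast
    then have "\<exists>t. a < t \<and> t < b \<and> poly (u i0) (of_real t) \<noteq> 0"
      by auto
    then obtain t where t: "a < t" "t < b" "poly (u i0) (of_real t) \<noteq> 0"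
      by blast
    obtain C where C: "pos_def_mat n C"
      and PC: "\<And>i j. i < n \<Longrightarrow> j < n \<Longrightarrow> C $$ (i, j) = poly (P $$ (i, j)) (of_real t)"
      using ab[OF t(1,2)] P by (auto dest!: has_value_at_to_fract)
    define w where "w = vec n (\<lambda>i. poly (u i) (of_real t))"
    have "w $ i0 \<noteq> 0"
      using i0 t by (simp add: w_def)
    then have "w \<noteq> 0\<^sub>v n"
      using i0 by auto
    then have "0 < (C *\<^sub>v w) \<bullet>c w"
      using C by (auto simp: pos_def_mat_def w_def)
    also have "(C *\<^sub>v w) \<bullet>c w = (\<Sum>i<n. (\<Sum>j<n. C $$ (i, j) * w $ j) * cnj (w $ i))"
      using C by (auto simp: pos_def_mat_def scalar_prod_def w_def lessThan_atLeast0 intro!: sum.cong)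
    also have "\<dots> = poly (\<Sum>i<n. map_poly cnj (u i) * (\<Sum>j<n. P $$ (i, j) * u j)) (of_real t)"
      by (simp add: poly_sum PC w_def poly_cnj_poly_of_real mult_ac)
    finally show False
      by (simp add: 0)
  qed
qed

section \<open>Coefficients of polynomial matrices\<close>

definition mcoef :: "complex poly mat \<Rightarrow> nat \<Rightarrow> complex mat" where
  "mcoef P j = map_mat (\<lambda>p. coeff p j) P"

text \<open>The adjoint at the polynomial level: it commutes both with taking coefficients and with
  the embedding into rational functions.\<close>

definition polymat_adjoint :: "complex poly mat \<Rightarrow> complex poly mat" where
  "polymat_adjoint P = map_mat (map_poly cnj) (transpose_mat P)"

lemma dim_mcoef [simp]: "dim_row (mcoef P j) = dim_row P" "dim_col (mcoef P j) = dim_col P"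
  by (simp_all add: mcoef_def)

lemma index_mcoef: "r < dim_row P \<Longrightarrow> c < dim_col P \<Longrightarrow> mcoef P j $$ (r, c) = coeff (P $$ (r, c)) j"
  by (simp add: mcoef_def)

lemma dim_msum [simp]: "dim_row (msum nr nc K f) = nr" "dim_col (msum nr nc K f) = nc"
  by (simp_all add: msum_def)

lemma index_msum: "r < nr \<Longrightarrow> c < nc \<Longrightarrow> msum nr nc K f $$ (r, c) = (\<Sum>k\<in>K. f k $$ (r, c))"
  by (simp add: msum_def)

lemma dim_polymat_adjoint [simp]:
  "dim_row (polymat_adjoint P) = dim_col P" "dim_col (polymat_adjoint P) = dim_row P"
  by (simp_all add: polymat_adjoint_def)

lemma dim_mat_adjoint [simp]:
  "dim_row (mat_adjoint P) = dim_col P" "dim_col (mat_adjoint P) = dim_row P"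
  by (simp_all add: mat_adjoint_def)

lemma mcoef_adjoint: "mcoef (polymat_adjoint P) j = mat_adjoint (mcoef P j)"
  by (rule eq_matI) (simp_all add: mcoef_def polymat_adjoint_def mat_adjoint_def mat_of_rows_index coeff_map_poly)

section \<open>Convolution formulas for products\<close>

lemma msum_cong [cong]:
  assumes "nr = nr'" "nc = nc'" "K = K'" and "\<And>k. k \<in> K' \<Longrightarrow> f k = g k"
  shows "msum nr nc K f = msum nr' nc' K' g"
  using assms by (auto simp: msum_def)

lemma msum_mult:
  assumes "\<And>k. k \<in> K \<Longrightarrow> dim_row (f k) = nr \<and> dim_col (f k) = nc" and "dim_row B = nc" "dim_col B = l"
  shows "msum nr nc K f * B = msum nr l K (\<lambda>k. f k * B)"
proof (rule eq_matI)
  fix r c assume "r < dim_row (msum nr l K (\<lambda>k. f k * B))" "c < dim_col (msum nr l K (\<lambda>k. f k * B))"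
  then show "(msum nr nc K f * B) $$ (r, c) = msum nr l K (\<lambda>k. f k * B) $$ (r, c)"
    using assms
    by (simp add: index_msum scalar_prod_def sum_distrib_right)
      (subst sum.swap, auto intro!: sum.cong)
qed (use assms in simp_all)

lemma smult_msum:
  assumes "\<And>k. k \<in> K \<Longrightarrow> dim_row (f k) = nr \<and> dim_col (f k) = nc"
  shows "x \<cdot>\<^sub>m msum nr nc K f = msum nr nc K (\<lambda>k. x \<cdot>\<^sub>m f k)"
  using assms by (intro eq_matI) (auto simp: index_msum sum_distrib_left)

lemma msum_minus:
  assumes "\<And>k. k \<in> K \<Longrightarrow> dim_row (g k) = nr \<and> dim_col (g k) = nc"
  shows "msum nr nc K (\<lambda>k. f k - g k) = msum nr nc K f - msum nr nc K g"
  using assms by (intro eq_matI) (auto simp: index_msum sum_subtractf)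

text \<open>The complementary index sits on the first factor, as in the usual pattern of the
  algorithm.\<close>

lemma coeff_mult': "coeff (p * q :: 'a::comm_semiring_0 poly) j = (\<Sum>k\<le>j. coeff p (j - k) * coeff q k)"
  by (simp only: mult.commute[of p q] coeff_mult) (simp add: mult.commute)

lemma mcoef_mult:
  assumes "dim_col P = dim_row Q"
  shows "mcoef (P * Q) j = msum (dim_row P) (dim_col Q) {..j} (\<lambda>k. mcoef P (j - k) * mcoef Q k)"
proof (rule eq_matI)
  fix r c assume "r < dim_row (msum (dim_row P) (dim_col Q) {..j} (\<lambda>k. mcoef P (j - k) * mcoef Q k))"
    "c < dim_col (msum (dim_row P) (dim_col Q) {..j} (\<lambda>k. mcoef P (j - k) * mcoef Q k))"
  then show "mcoef (P * Q) j $$ (r, c) =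
      msum (dim_row P) (dim_col Q) {..j} (\<lambda>k. mcoef P (j - k) * mcoef Q k) $$ (r, c)"
    using assms
    by (simp add: index_msum index_mcoef scalar_prod_def coeff_sum coeff_mult') (rule sum.swap)
qed simp_all

text \<open>Two versions, since the algorithm attaches the summation index sometimes to the matrix
  and sometimes to the scalar.\<close>

lemma mcoef_smult: "mcoef (y \<cdot>\<^sub>m P) j = msum (dim_row P) (dim_col P) {..j} (\<lambda>k. coeff y (j - k) \<cdot>\<^sub>m mcoef P k)"
  by (rule eq_matI) (simp_all add: index_msum index_mcoef coeff_mult')

lemma mcoef_smult': "mcoef (y \<cdot>\<^sub>m P) j = msum (dim_row P) (dim_col P) {..j} (\<lambda>k. coeff y k \<cdot>\<^sub>m mcoef P (j - k))"
  by (rule eq_matI) (simp_all add: index_msum index_mcoef coeff_mult)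

lemma mcoef_minus:
  "dim_row P = dim_row Q \<Longrightarrow> dim_col P = dim_col Q \<Longrightarrow> mcoef (P - Q) j = mcoef P j - mcoef Q j"
  by (rule eq_matI) (simp_all add: index_mcoef)

lemma mcoef_append_rows: "dim_col P = dim_col Q \<Longrightarrow> mcoef (P @\<^sub>r Q) j = mcoef P j @\<^sub>r mcoef Q j"
  by (rule eq_matI) (auto simp: index_mcoef append_rows_def)

section \<open>Degree bounds and truncation\<close>

lemma mat_degree_leD: "mat_degree_le P b \<Longrightarrow> i < dim_row P \<Longrightarrow> j < dim_col P \<Longrightarrow> degree (P $$ (i, j)) \<le> b"
  by (simp add: mat_degree_le_def)

lemma mat_degree_le_mult:
  assumes "mat_degree_le P x" "mat_degree_le Q y" "dim_col P = dim_row Q" "x + y \<le> b"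
  shows "mat_degree_le (P * Q) b"
  unfolding mat_degree_le_def
proof (intro allI impI)
  fix i j assume "i < dim_row (P * Q)" "j < dim_col (P * Q)"
  then show "degree ((P * Q) $$ (i, j)) \<le> b"
    using assms
    by (auto simp: scalar_prod_def
      intro!: degree_sum_le order_trans[OF degree_mult_le] order_trans[OF add_mono \<open>x + y \<le> b\<close>] mat_degree_leD)
qed

lemma mat_degree_le_smult:
  assumes "degree p \<le> x" "mat_degree_le Q y" "x + y \<le> b"
  shows "mat_degree_le (p \<cdot>\<^sub>m Q) b"
  unfolding mat_degree_le_def
proof (intro allI impI)
  fix i j assume "i < dim_row (p \<cdot>\<^sub>m Q)" "j < dim_col (p \<cdot>\<^sub>m Q)"
  then show "degree ((p \<cdot>\<^sub>m Q) $$ (i, j)) \<le> b"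
    using assms
    by (auto intro!: order_trans[OF degree_mult_le] order_trans[OF add_mono \<open>x + y \<le> b\<close>] mat_degree_leD)
qed

lemma mat_degree_le_minus:
  "mat_degree_le P b \<Longrightarrow> mat_degree_le Q b \<Longrightarrow> dim_row P = dim_row Q \<Longrightarrow> dim_col P = dim_col Q \<Longrightarrow>
    mat_degree_le (P - Q) b"
  by (auto simp: mat_degree_le_def intro: degree_diff_le)

lemma mat_degree_le_mono: "mat_degree_le P x \<Longrightarrow> x \<le> b \<Longrightarrow> mat_degree_le P b"
  by (auto simp: mat_degree_le_def intro: order_trans)

lemma mat_degree_le_one: "mat_degree_le (1\<^sub>m k) b"
  by (auto simp: mat_degree_le_def)

lemma mat_degree_le_adjoint: "mat_degree_le P b \<Longrightarrow> mat_degree_le (polymat_adjoint P) b"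
  by (auto simp: mat_degree_le_def polymat_adjoint_def intro: order_trans[OF degree_map_poly_le])

lemma mat_degree_le_append_rows:
  "mat_degree_le P b \<Longrightarrow> mat_degree_le Q b \<Longrightarrow> dim_col P = dim_col Q \<Longrightarrow> mat_degree_le (P @\<^sub>r Q) b"
  by (auto simp: mat_degree_le_def append_rows_def)

text \<open>Splits each coefficient sequence into two tasks: the convolution identity at every
  index, also beyond \<open>b\<close>, and the degree bound that makes the truncation
  harmless.\<close>

lemma upto_deg_mcoef:
  assumes "\<And>j. f j = mcoef P j" and "mat_degree_le P b" and "P \<in> carrier_mat nr nc"
  shows "upto_deg b (0\<^sub>m nr nc) f = mcoef P"
proof
  fix j show "upto_deg b (0\<^sub>m nr nc) f j = mcoef P j"
  proof (cases "j \<le> b")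
    case False
    then have "coeff (P $$ (r, c)) j = 0" if "r < nr" "c < nc" for r c
      using that assms(3) mat_degree_leD[OF assms(2), of r c] by (intro coeff_eq_0) auto
    then show ?thesis
      using False assms(3) by (auto simp: upto_deg_def index_mcoef intro!: eq_matI)
  qed (simp add: upto_deg_def assms(1))
qed

lemma upto_deg_coeff:
  assumes "\<And>j. f j = coeff p j" and "degree p \<le> b"
  shows "upto_deg b 0 f = coeff p"
  using assms by (auto simp: upto_deg_def fun_eq_iff coeff_eq_0)

text \<open>Turns the branching tests of the algorithm into tests on polynomial matrices.\<close>

lemma mcoef_eq_0_iff:
  assumes "P \<in> carrier_mat nr nc"
  shows "(\<exists>j. mcoef P j \<noteq> 0\<^sub>m nr nc) \<longleftrightarrow> P \<noteq> 0\<^sub>m nr nc"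
proof -
  have "P = 0\<^sub>m nr nc" if *: "\<And>j. mcoef P j = 0\<^sub>m nr nc"
  proof (rule eq_matI)
    fix r c assume rc: "r < dim_row (0\<^sub>m nr nc)" "c < dim_col (0\<^sub>m nr nc)"
    then have "mcoef P j $$ (r, c) = 0" for j
      using * by simp
    then show "P $$ (r, c) = 0\<^sub>m nr nc $$ (r, c)"
      using rc assms by (simp add: index_mcoef poly_eq_iff)
  qed (use assms in auto)
  moreover have "mcoef (0\<^sub>m nr nc) j = 0\<^sub>m nr nc" for j
    by (rule eq_matI) (simp_all add: index_mcoef)
  ultimately show ?thesis
    by blast
qed

section \<open>The embedding into matrices of rational functions\<close>

lemma ratmat_mult: "dim_col P = dim_row Q \<Longrightarrow> ratmat (P * Q) = ratmat P * ratmat Q"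
  by (rule eq_matI) (auto simp: scalar_prod_def to_fract_sum)

lemma ratmat_minus:
  "dim_row P = dim_row Q \<Longrightarrow> dim_col P = dim_col Q \<Longrightarrow> ratmat (P - Q) = ratmat P - ratmat Q"
  by (rule eq_matI) auto

lemma ratmat_smult: "ratmat (p \<cdot>\<^sub>m Q) = to_fract p \<cdot>\<^sub>m ratmat Q"
  by (rule eq_matI) auto

lemma ratmat_adjoint_ratmat: "ratmat_adjoint (ratmat P) = ratmat (polymat_adjoint P)"
  by (rule eq_matI) (auto simp: index_ratmat_adjoint polymat_adjoint_def fract_cnj_to_fract)

lemma ratmat_one: "ratmat (1\<^sub>m k) = 1\<^sub>m k"
  by (rule eq_matI) auto

lemma ratmat_append_rows: "dim_col P = dim_col Q \<Longrightarrow> ratmat (P @\<^sub>r Q) = ratmat P @\<^sub>r ratmat Q"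
  by (rule eq_matI) (auto simp: append_rows_def)

lemma ratmat_eq_0_iff: "ratmat P = 0\<^sub>m k l \<longleftrightarrow> P = 0\<^sub>m k l"
  by (auto simp: mat_eq_iff)

lemmas ratmat_simps = ratmat_mult ratmat_minus ratmat_smult ratmat_one

section \<open>Polynomial form of one step\<close>

locale wmp_correct = wmp_algorithm +
  fixes n :: nat
  assumes n: "1 \<le> n"
    and A: "A \<in> carrier_mat m n" and degA: "mat_degree_le A q"
    and degM: "mat_degree_le M mq" and posM: "pos_def_ratmat m (ratmat M)"
    and degN: "mat_degree_le N nq" and posN: "pos_def_ratmat n (ratmat N)"
    and Nnum: "\<And>k. 1 \<le> k \<Longrightarrow> k < n \<Longrightarrow> Nnum k \<in> carrier_mat k k \<and> mat_degree_le (Nnum k) (nnd k)"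
    and Nden: "\<And>k. 1 \<le> k \<Longrightarrow> k < n \<Longrightarrow>
      Nden k \<noteq> 0 \<and> degree (Nden k) \<le> ndd k \<and> (\<forall>j. coeff (Nden k) j \<in> \<real>)"
    and Ninv: "\<And>k. 1 \<le> k \<Longrightarrow> k < n \<Longrightarrow>
      inverts_mat (ratmat (leading_submat k N))
        (map_mat (\<lambda>p. to_fract p / to_fract (Nden k)) (Nnum k)) \<and>
      inverts_mat (map_mat (\<lambda>p. to_fract p / to_fract (Nden k)) (Nnum k))
        (ratmat (leading_submat k N))"
begin

definition "acol i = mat m 1 (\<lambda>(r, c). A $$ (r, i - 1))"
definition "Ahat i = mat m i (\<lambda>(r, c). A $$ (r, c))"
definition "Lcol i = mat (i - 1) 1 (\<lambda>(r, c). N $$ (r, i - 1))"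
abbreviation "Nlead i \<equiv> leading_submat i N"

lemma dims [simp]:
  "dim_row A = m" "dim_col A = n" "dim_row M = m" "dim_col M = m" "dim_row N = n" "dim_col N = n"
  "dim_row (acol i) = m" "dim_col (acol i) = 1" "dim_row (Ahat i) = m" "dim_col (Ahat i) = i"
  "dim_row (Lcol i) = i - 1" "dim_col (Lcol i) = 1" "dim_row (Nlead i) = i" "dim_col (Nlead i) = i"
  using A posM posN
  by (auto simp: pos_def_ratmat_def acol_def Ahat_def Lcol_def leading_submat_def)

lemma coef_eq_mcoef:
  "a_coef i = mcoef (acol i)" "Ahat_coef i = mcoef (Ahat i)" "M_coef = mcoef M"
  "N_coef i = mcoef (Nlead i)" "L_coef i = mcoef (Lcol i)" "Nnum_coef i = mcoef (Nnum i)"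
  "Nden_coef i = coeff (Nden i)" "n_coef i = coeff (N $$ (i - 1, i - 1))" "I_coef i = mcoef (1\<^sub>m i)"
  by (auto simp: fun_eq_iff a_coef_def Ahat_coef_def M_coef_def N_coef_def L_coef_def Nnum_coef_def
      Nden_coef_def n_coef_def I_coef_def acol_def Ahat_def Lcol_def mcoef_def intro!: eq_matI)

lemma degree_acol: "1 \<le> i \<Longrightarrow> i \<le> n \<Longrightarrow> mat_degree_le (acol i) q"
  and degree_Ahat: "i \<le> n \<Longrightarrow> mat_degree_le (Ahat i) q"
  and degree_Lcol: "1 \<le> i \<Longrightarrow> i \<le> n \<Longrightarrow> mat_degree_le (Lcol i) nq"
  and degree_Nlead: "i \<le> n \<Longrightarrow> mat_degree_le (Nlead i) nq"
  using degA degN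
  by (auto simp: mat_degree_le_def acol_def Ahat_def Lcol_def leading_submat_def)

end

text \<open>The formal side of one step, with \<open>k\<close> the number of the previous one. That
  \<open>Z / Y\<close> is a weighted inverse enters later, in \<open>correct_step\<close>.\<close>

locale wmp_step = wmp_correct +
  fixes k :: nat and S :: wmp_state and Z :: "complex poly mat" and Y :: "complex poly"
  assumes k: "1 \<le> k" "k < n"
    and Z: "Z \<in> carrier_mat k m" and Zc: "Zc S = mcoef Z" and degZ: "mat_degree_le Z (Zdeg S)"
    and Yc: "Yc S = coeff Y" and degY: "degree Y \<le> Ydeg S"
begin

text \<open>Numerators of the quantities of \<open>appended_column\<close>:
  \<open>d = D / Y\<close>, \<open>c = C / Y\<close>, \<open>p = Phi / (Y Nden)\<close>. The scalar
  inverted in \<open>b\<close> is \<open>Wa / Y^2\<close> for nonzero \<open>c\<close> and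
  \<open>Delta2 / (Y^2 Nden)\<close> otherwise; in either case \<open>b = V / W\<close>.\<close>

definition "D = Z * acol (Suc k)"
definition "C = Y \<cdot>\<^sub>m acol (Suc k) - Ahat k * D"
definition "Phi = (Y \<cdot>\<^sub>m 1\<^sub>m k - Z * Ahat k) * Nnum k * Lcol (Suc k)"
definition "Psi = Y * Nden k"
definition "Va = (Y \<cdot>\<^sub>m polymat_adjoint C) * M"
definition "Wa = (polymat_adjoint C * M * C) $$ (0, 0)"
definition "Delta1 = Y * Y * Nden k"
definition "Delta2 =
  (N $$ (k, k) * Y * Y + (polymat_adjoint D * Nlead k * D) $$ (0, 0)
    - (polymat_adjoint D * Lcol (Suc k)) $$ (0, 0) * Y
    - (polymat_adjoint (Lcol (Suc k)) * D) $$ (0, 0) * Y) * Nden k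
  - (polymat_adjoint (Lcol (Suc k)) * Phi) $$ (0, 0) * Y"
text \<open>The scalar \<open>Delta1\<close> is distributed over both terms and grouped so that
  iterated convolution assigns the summation indices as the algorithm does.\<close>

definition "Vb = ((Delta1 \<cdot>\<^sub>m polymat_adjoint D) * Nlead k
  - Y \<cdot>\<^sub>m (Delta1 \<cdot>\<^sub>m polymat_adjoint (Lcol (Suc k)))) * Z"
definition "Wb = Delta2 * Y * Y"
definition "V = (if C \<noteq> 0\<^sub>m m 1 then Va else Vb)"
definition "W = (if C \<noteq> 0\<^sub>m m 1 then Wa else Wb)"
definition "Theta = W \<cdot>\<^sub>m (Nden k \<cdot>\<^sub>m Z) - (Nden k \<cdot>\<^sub>m D) * V - Phi * V"
definition "Znext = Theta @\<^sub>r (Psi \<cdot>\<^sub>m V)"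
definition "Ynext = Psi * W"

lemma Suc_k: "1 \<le> Suc k" "Suc k \<le> n"
  using k by auto

lemma dims_step [simp]:
  "dim_row Z = k" "dim_col Z = m" "dim_row (Nnum k) = k" "dim_col (Nnum k) = k"
  "dim_row D = k" "dim_col D = 1" "dim_row C = m" "dim_col C = 1" "dim_row Phi = k" "dim_col Phi = 1"
  "dim_row Va = 1" "dim_col Va = m" "dim_row Vb = 1" "dim_col Vb = m" "dim_row V = 1" "dim_col V = m"
  "dim_row Theta = k" "dim_col Theta = m" "dim_row Znext = Suc k" "dim_col Znext = m"
  using Z Nnum[OF k]
  by (auto simp: D_def C_def Phi_def Va_def Vb_def V_def Theta_def Znext_def)

text \<open>\<open>qhat\<close> bounds \<open>Y\<close>, \<open>D\<close> and
  \<open>Z * Ahat k\<close> at once, and all further bounds follow by adding degrees.\<close>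

lemma degree_step:
  "degree (Nden k) \<le> ndd k" "mat_degree_le (Nnum k) (nnd k)"
  "mat_degree_le D (Zdeg S + q)" "mat_degree_le C (qhat S + q)"
  "mat_degree_le Phi (qhat S + nnd k + nq)" "degree Psi \<le> Ydeg S + ndd k"
  "mat_degree_le Va (Va_deg S)" "degree Wa \<le> Wa_deg S"
  "degree Delta1 \<le> 2 * Ydeg S + ndd k" "degree Delta2 \<le> Delta2_deg (Suc k) S"
  "mat_degree_le Vb (Vb_deg (Suc k) S)" "degree Wb \<le> Wb_deg (Suc k) S"
proof -
  show Nden': "degree (Nden k) \<le> ndd k" and Nnum': "mat_degree_le (Nnum k) (nnd k)"
    using Nnum[OF k] Nden[OF k] by auto
  show D: "mat_degree_le D (Zdeg S + q)"
    unfolding D_def by (rule mat_degree_le_mult[OF degZ degree_acol]) (use k in auto)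
  have D': "mat_degree_le D (qhat S)"
    by (rule mat_degree_le_mono[OF D]) (simp add: qhat_def)
  have Y': "degree Y \<le> qhat S"
    using degY by (simp add: qhat_def)
  show C: "mat_degree_le C (qhat S + q)"
    unfolding C_def
    by (rule mat_degree_le_minus mat_degree_le_smult[OF Y' degree_acol]
      mat_degree_le_mult[OF degree_Ahat D'] | use k in simp)+
  have ZA: "mat_degree_le (Z * Ahat k) (qhat S)"
    by (rule mat_degree_le_mult[OF degZ degree_Ahat]) (use k in \<open>auto simp: qhat_def\<close>)
  have "mat_degree_le (Y \<cdot>\<^sub>m 1\<^sub>m k - Z * Ahat k) (qhat S)"
    by (rule mat_degree_le_minus mat_degree_le_smult[OF Y' mat_degree_le_one[of _ 0]] ZA | simp)+
  then have "mat_degree_le ((Y \<cdot>\<^sub>m 1\<^sub>m k - Z * Ahat k) * Nnum k) (qhat S + nnd k)"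
    by (rule mat_degree_le_mult[OF _ Nnum']) auto
  then show Phi: "mat_degree_le Phi (qhat S + nnd k + nq)"
    unfolding Phi_def by (rule mat_degree_le_mult[OF _ degree_Lcol[OF Suc_k]]) auto
  show "degree Psi \<le> Ydeg S + ndd k"
    unfolding Psi_def by (rule order_trans[OF degree_mult_le add_mono[OF degY Nden']])
  note C' = mat_degree_le_adjoint[OF C] and D'' = mat_degree_le_adjoint[OF D']
    and L = degree_Lcol[OF Suc_k] and L' = mat_degree_le_adjoint[OF degree_Lcol[OF Suc_k]]
  show "mat_degree_le Va (Va_deg S)"
    unfolding Va_def
    by (rule mat_degree_le_mult[OF mat_degree_le_smult[OF degY C' order_refl] degM])
      (simp_all add: Va_deg_def)
  have "mat_degree_le (polymat_adjoint C * M * C) (Wa_deg S)"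
    by (rule mat_degree_le_mult[OF mat_degree_le_mult[OF C' degM _ order_refl] C])
      (simp_all add: Wa_deg_def)
  from mat_degree_leD[OF this, of 0 0] show "degree Wa \<le> Wa_deg S"
    by (simp add: Wa_def del: index_mult_mat(1))
  have "degree (Y * Y) \<le> 2 * Ydeg S"
    using degree_mult_le[of Y Y] degY by simp
  then show D1: "degree Delta1 \<le> 2 * Ydeg S + ndd k"
    unfolding Delta1_def using degree_mult_le[of "Y * Y" "Nden k"] Nden' by simp
  \<comment> \<open>A common bound for the four terms of \<open>Delta2\<close> that are multiplied
    by \<open>Nden k\<close>. The maximum in \<open>Delta2_deg\<close> compares this factor with the
    excess \<open>nq + nnd k\<close> of the term containing \<open>Phi\<close>.\<close>
  define b where "b = 2 * qhat S + nq"
  have "degree (N $$ (k, k) * Y * Y) \<le> b"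
    using degree_mult_le[of "N $$ (k, k)" Y] degree_mult_le[of "N $$ (k, k) * Y" Y] Y'
      mat_degree_leD[OF degN, of k k] k
    by (simp add: b_def)
  moreover have "mat_degree_le (polymat_adjoint D * Nlead k * D) b"
    by (rule mat_degree_le_mult[OF mat_degree_le_mult[OF D'' degree_Nlead _ order_refl] D'])
      (use k in \<open>simp_all add: b_def\<close>)
  from mat_degree_leD[OF this, of 0 0] have "degree ((polymat_adjoint D * Nlead k * D) $$ (0, 0)) \<le> b"
    by (simp del: index_mult_mat(1))
  moreover have "mat_degree_le (polymat_adjoint D * Lcol (Suc k)) (qhat S + nq)"
    by (rule mat_degree_le_mult[OF D'' L]) simp_all
  from mat_degree_leD[OF this, of 0 0]
  have "degree ((polymat_adjoint D * Lcol (Suc k)) $$ (0, 0) * Y) \<le> b"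
    using degree_mult_le[of "(polymat_adjoint D * Lcol (Suc k)) $$ (0, 0)" Y] Y'
    by (simp add: b_def del: index_mult_mat(1))
  moreover have "mat_degree_le (polymat_adjoint (Lcol (Suc k)) * D) (qhat S + nq)"
    by (rule mat_degree_le_mult[OF L' D']) simp_all
  from mat_degree_leD[OF this, of 0 0]
  have "degree ((polymat_adjoint (Lcol (Suc k)) * D) $$ (0, 0) * Y) \<le> b"
    using degree_mult_le[of "(polymat_adjoint (Lcol (Suc k)) * D) $$ (0, 0)" Y] Y'
    by (simp add: b_def del: index_mult_mat(1))
  ultimately have 1: "degree (N $$ (k, k) * Y * Y + (polymat_adjoint D * Nlead k * D) $$ (0, 0)
    - (polymat_adjoint D * Lcol (Suc k)) $$ (0, 0) * Y
    - (polymat_adjoint (Lcol (Suc k)) * D) $$ (0, 0) * Y) \<le> b" (is "degree ?Q \<le> _")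
    by (intro degree_diff_le degree_add_le)
  have "mat_degree_le (polymat_adjoint (Lcol (Suc k)) * Phi) (qhat S + nq + (nq + nnd k))"
    by (rule mat_degree_le_mult[OF L' Phi]) simp_all
  from mat_degree_leD[OF this, of 0 0]
  have 2: "degree ((polymat_adjoint (Lcol (Suc k)) * Phi) $$ (0, 0) * Y) \<le> b + (nq + nnd k)"
    using degree_mult_le[of "(polymat_adjoint (Lcol (Suc k)) * Phi) $$ (0, 0)" Y] Y'
    by (simp add: b_def del: index_mult_mat(1))
  have Delta2_deg: "Delta2_deg (Suc k) S = b + max (nq + nnd k) (ndd k)"
    by (simp add: Delta2_deg_def b_def)
  show D2: "degree Delta2 \<le> Delta2_deg (Suc k) S"
    unfolding Delta2_def Delta2_deg
  proof (rule degree_diff_le)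
    show "degree (?Q * Nden k) \<le> b + max (nq + nnd k) (ndd k)"
      using degree_mult_le[of ?Q "Nden k"] 1 Nden' by linarith
  qed (use 2 in linarith)
  show "mat_degree_le Vb (Vb_deg (Suc k) S)"
    unfolding Vb_def
  proof (rule mat_degree_le_mult[OF _ degZ])
    show "mat_degree_le (Delta1 \<cdot>\<^sub>m polymat_adjoint D * Nlead k - Y \<cdot>\<^sub>m (Delta1 \<cdot>\<^sub>m polymat_adjoint (Lcol (Suc k))))
        (2 * Ydeg S + ndd k + qhat S + nq)"
    proof (rule mat_degree_le_minus)
      show "mat_degree_le (Delta1 \<cdot>\<^sub>m polymat_adjoint D * Nlead k) (2 * Ydeg S + ndd k + qhat S + nq)"
        by (rule mat_degree_le_mult[OF mat_degree_le_smult[OF D1 D'' order_refl] degree_Nlead])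
          (use k in simp_all)
      show "mat_degree_le (Y \<cdot>\<^sub>m (Delta1 \<cdot>\<^sub>m polymat_adjoint (Lcol (Suc k)))) (2 * Ydeg S + ndd k + qhat S + nq)"
        by (rule mat_degree_le_smult[OF Y' mat_degree_le_smult[OF D1 L' order_refl]]) simp
    qed simp_all
  qed (simp_all add: Vb_deg_def)
  show "degree Wb \<le> Wb_deg (Suc k) S"
    using degree_mult_le[of Delta2 Y] degree_mult_le[of "Delta2 * Y" Y] D2 degY
    by (simp add: Wb_def Wb_deg_def Delta2_deg_def)
qed

section \<open>The coefficient sequences of one step as convolutions\<close>

lemma d_coef: "d_coef (Suc k) S = mcoef D"
  unfolding d_coef_def
proof (rule upto_deg_mcoef)
  fix j
  show "msum (Suc k - 1) 1 {..j} (\<lambda>ka. Zc S (j - ka) * a_coef (Suc k) ka) = mcoef D j"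
    by (simp add: D_def mcoef_mult Zc coef_eq_mcoef)
qed (simp_all add: degree_step carrier_matI)

lemma c_coef: "c_coef (Suc k) S = mcoef C"
  unfolding c_coef_def
proof (rule upto_deg_mcoef)
  fix j
  show "msum m 1 {..j} (\<lambda>ka. Yc S ka \<cdot>\<^sub>m a_coef (Suc k) (j - ka)
      - Ahat_coef (Suc k - 1) (j - ka) * d_coef (Suc k) S ka) = mcoef C j"
    by (simp add: C_def mcoef_minus mcoef_mult mcoef_smult' d_coef Yc coef_eq_mcoef msum_minus)
qed (simp_all add: degree_step carrier_matI)

lemma phi_coef: "phi_coef (Suc k) S = mcoef Phi"
  unfolding phi_coef_def
proof (rule upto_deg_mcoef)
  fix j
  show "msum (Suc k - 1) 1 {..j} (\<lambda>t. msum (Suc k - 1) 1 {..j - t} (\<lambda>r.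
        msum (Suc k - 1) 1 {..j - t - r} (\<lambda>ka.
          (Yc S (j - ka - r - t) \<cdot>\<^sub>m I_coef (Suc k - 1) ka
             - Zc S (j - ka - r - t) * Ahat_coef (Suc k - 1) ka)
          * Nnum_coef (Suc k - 1) r * L_coef (Suc k) t))) = mcoef Phi j"
    \<comment> \<open>Unfolding the products yields the same triple sum up to the order in which the
      indices are subtracted from \<open>j\<close>; the second method settles this. Removing
      \<open>assoc_mult_mat\<close> preserves the bracketing of the algorithm.\<close>
    by (simp add: Phi_def mcoef_minus mcoef_mult mcoef_smult coef_eq_mcoef Zc Yc msum_mult
        msum_minus[symmetric] del: assoc_mult_mat)
      (intro msum_cong refl, simp add: ac_simps del: assoc_mult_mat)
qed (simp_all add: degree_step carrier_matI)

lemma psi_coef: "psi_coef (Suc k) S = coeff Psi"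
  unfolding psi_coef_def
proof (rule upto_deg_coeff)
  fix j
  show "(\<Sum>ka\<le>j. Yc S (j - ka) * Nden_coef (Suc k - 1) ka) = coeff Psi j"
    by (simp add: Psi_def coeff_mult' coef_eq_mcoef Yc)
qed (simp_all add: degree_step)

lemma c_nonzero: "c_nonzero (Suc k) S \<longleftrightarrow> C \<noteq> 0\<^sub>m m 1"
  unfolding c_nonzero_def c_coef by (rule mcoef_eq_0_iff) (simp add: carrier_matI)

lemma Va_coef: "Va_coef (Suc k) S = mcoef Va"
  unfolding Va_coef_def
proof (rule upto_deg_mcoef)
  fix j
  show "msum 1 m {..j} (\<lambda>r. msum 1 m {..j - r} (\<lambda>ka.
        Yc S (j - ka - r) \<cdot>\<^sub>m (mat_adjoint (c_coef (Suc k) S ka) * M_coef r))) = mcoef Va j"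
    by (simp add: Va_def mcoef_mult mcoef_smult mcoef_adjoint coef_eq_mcoef Yc c_coef msum_mult
        mat_mult_smult_left[where 'a = complex] del: assoc_mult_mat)
      (intro msum_cong refl, simp add: ac_simps del: assoc_mult_mat)
qed (simp_all add: degree_step carrier_matI)

lemma Wa_coef: "Wa_coef (Suc k) S = coeff Wa"
  unfolding Wa_coef_def
proof (rule upto_deg_coeff)
  fix j
  have "coeff Wa j = mcoef (polymat_adjoint C * M * C) j $$ (0, 0)"
    by (simp add: Wa_def index_mcoef del: index_mult_mat(1))
  also have "\<dots> = (\<Sum>r\<le>j. \<Sum>ka\<le>j - r.
      (mat_adjoint (mcoef C (j - r - ka)) * mcoef M ka * mcoef C r) $$ (0, 0))"
    by (simp add: mcoef_mult mcoef_adjoint msum_mult index_msum del: assoc_mult_mat index_mult_mat(1))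
  finally show "(\<Sum>r\<le>j. \<Sum>ka\<le>j - r.
        (mat_adjoint (c_coef (Suc k) S (j - ka - r)) * M_coef ka * c_coef (Suc k) S r) $$ (0, 0)) = coeff Wa j"
    by (simp add: c_coef coef_eq_mcoef add.commute del: assoc_mult_mat index_mult_mat(1))
qed (simp_all add: degree_step)

lemma Delta1_coef: "Delta1_coef (Suc k) S = coeff Delta1"
  unfolding Delta1_coef_def
proof (rule upto_deg_coeff)
  fix j
  show "(\<Sum>r\<le>j. \<Sum>ka\<le>j - r. Yc S (j - ka - r) * Yc S ka * Nden_coef (Suc k - 1) r) = coeff Delta1 j"
    by (simp add: Delta1_def coeff_mult' sum_distrib_right coef_eq_mcoef Yc add.commute)
qed (simp_all add: degree_step)

text \<open>Scalars given as entries of \<open>1 x 1\<close> products thereby fall under the matrix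
  convolution rules.\<close>

lemma coeff_entry: "coeff (P $$ (0, 0)) j = mcoef P j $$ (0, 0)" if "0 < dim_row P" "0 < dim_col P"
  using that by (simp add: index_mcoef)

lemma Delta2_coef: "Delta2_coef (Suc k) S = coeff Delta2"
  unfolding Delta2_coef_def
proof (rule upto_deg_coeff)
  fix j
  let ?L = "polymat_adjoint (Lcol (Suc k))" and ?D = "polymat_adjoint D"
  \<comment> \<open>The index \<open>t\<close> of the outer factor \<open>Nden k\<close> is fixed
    first; what remains is a double convolution at \<open>j - t\<close> in each of the four
    terms.\<close>
  have 1: "coeff ((N $$ (k, k) * Y * Y + (?D * Nlead k * D) $$ (0, 0) - (?D * Lcol (Suc k)) $$ (0, 0) * Y
      - (?L * D) $$ (0, 0) * Y) * Nden k) j =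
    (\<Sum>t\<le>j. \<Sum>r\<le>j - t. \<Sum>ka\<le>j - r - t.
             (n_coef (Suc k) (j - ka - r - t) * Yc S ka * Yc S r
              + (mat_adjoint (d_coef (Suc k) S (j - ka - r - t)) * N_coef (Suc k - 1) ka * d_coef (Suc k) S r) $$ (0, 0)
              - (mat_adjoint (d_coef (Suc k) S (j - ka - r - t)) * L_coef (Suc k) ka) $$ (0, 0) * Yc S r
              - (mat_adjoint (L_coef (Suc k) (j - ka - r - t)) * d_coef (Suc k) S ka) $$ (0, 0) * Yc S r)
             * Nden_coef (Suc k - 1) t)"
    unfolding coeff_mult'[of _ "Nden k"]
  proof (rule sum.cong[OF refl])
    fix t
    show "coeff (N $$ (k, k) * Y * Y + (?D * Nlead k * D) $$ (0, 0) - (?D * Lcol (Suc k)) $$ (0, 0) * Y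
        - (?L * D) $$ (0, 0) * Y) (j - t) * coeff (Nden k) t =
      (\<Sum>r\<le>j - t. \<Sum>ka\<le>j - r - t.
             (n_coef (Suc k) (j - ka - r - t) * Yc S ka * Yc S r
              + (mat_adjoint (d_coef (Suc k) S (j - ka - r - t)) * N_coef (Suc k - 1) ka * d_coef (Suc k) S r) $$ (0, 0)
              - (mat_adjoint (d_coef (Suc k) S (j - ka - r - t)) * L_coef (Suc k) ka) $$ (0, 0) * Yc S r
              - (mat_adjoint (L_coef (Suc k) (j - ka - r - t)) * d_coef (Suc k) S ka) $$ (0, 0) * Yc S r)
             * Nden_coef (Suc k - 1) t)"
      by (simp add: coeff_mult' coeff_entry mcoef_mult mcoef_adjoint msum_mult index_msum
          sum_distrib_right sum.distrib sum_subtractf ring_distribs d_coef coef_eq_mcoef Yc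
          del: assoc_mult_mat index_mult_mat(1))
        (simp add: add_ac del: assoc_mult_mat index_mult_mat(1))
  qed
  have 2: "coeff ((?L * Phi) $$ (0, 0) * Y) j =
      (\<Sum>r\<le>j. \<Sum>ka\<le>j - r. (mat_adjoint (L_coef (Suc k) (j - ka - r)) * phi_coef (Suc k) S ka) $$ (0, 0) * Yc S r)"
    by (simp add: coeff_mult' coeff_entry mcoef_mult mcoef_adjoint index_msum
        sum_distrib_right phi_coef coef_eq_mcoef Yc add.commute del: assoc_mult_mat index_mult_mat(1))
  show "(\<Sum>t\<le>j. \<Sum>r\<le>j - t. \<Sum>ka\<le>j - r - t.
             (n_coef (Suc k) (j - ka - r - t) * Yc S ka * Yc S r
              + (mat_adjoint (d_coef (Suc k) S (j - ka - r - t)) * N_coef (Suc k - 1) ka * d_coef (Suc k) S r) $$ (0, 0)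
              - (mat_adjoint (d_coef (Suc k) S (j - ka - r - t)) * L_coef (Suc k) ka) $$ (0, 0) * Yc S r
              - (mat_adjoint (L_coef (Suc k) (j - ka - r - t)) * d_coef (Suc k) S ka) $$ (0, 0) * Yc S r)
             * Nden_coef (Suc k - 1) t)
      - (\<Sum>r\<le>j. \<Sum>ka\<le>j - r. (mat_adjoint (L_coef (Suc k) (j - ka - r)) * phi_coef (Suc k) S ka) $$ (0, 0) * Yc S r)
      = coeff Delta2 j"
    unfolding Delta2_def coeff_diff 1 2 ..
qed (simp_all add: degree_step)

lemma Vb_coef: "Vb_coef (Suc k) S = mcoef Vb"
  unfolding Vb_coef_def
proof (rule upto_deg_mcoef)
  fix j
  let ?L = "polymat_adjoint (Lcol (Suc k))" and ?D = "polymat_adjoint D"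
  \<comment> \<open>Both terms carry \<open>Delta1\<close> with the same index, so it factors out of
    their difference.\<close>
  have P: "mcoef (Delta1 \<cdot>\<^sub>m ?D * Nlead k - Y \<cdot>\<^sub>m (Delta1 \<cdot>\<^sub>m ?L)) j =
      msum 1 k {..j} (\<lambda>r. msum 1 k {..j - r} (\<lambda>ka. coeff Delta1 (j - r - ka) \<cdot>\<^sub>m
        (mat_adjoint (mcoef D ka) * mcoef (Nlead k) r - coeff Y r \<cdot>\<^sub>m mat_adjoint (mcoef (Lcol (Suc k)) ka))))"
    for j
    by (simp add: mcoef_minus mcoef_mult mcoef_smult'[of Y] mcoef_smult[of Delta1] mcoef_adjoint msum_mult
        smult_msum msum_minus mat_smult_minus mat_smult_smult[where 'a = complex] mat_mult_smult_left[where 'a = complex]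
        mult.commute del: assoc_mult_mat)
  show "msum 1 m {..j} (\<lambda>t. msum 1 m {..j - t} (\<lambda>r. msum 1 m {..j - t - r} (\<lambda>ka.
        Delta1_coef (Suc k) S (j - ka - r - t) \<cdot>\<^sub>m
          ((mat_adjoint (d_coef (Suc k) S ka) * N_coef (Suc k - 1) r
              - Yc S r \<cdot>\<^sub>m mat_adjoint (L_coef (Suc k) ka)) * Zc S t)))) = mcoef Vb j"
    by (simp add: Vb_def mcoef_mult P msum_mult mat_mult_smult_left[where 'a = complex]
        Delta1_coef d_coef coef_eq_mcoef Yc Zc del: assoc_mult_mat)
      (intro msum_cong refl, simp add: ac_simps del: assoc_mult_mat)
qed (simp_all add: degree_step carrier_matI)

lemma Wb_coef: "Wb_coef (Suc k) S = coeff Wb"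
  unfolding Wb_coef_def
proof (rule upto_deg_coeff)
  fix j
  show "(\<Sum>r\<le>j. \<Sum>ka\<le>j - r. Delta2_coef (Suc k) S (j - ka - r) * Yc S ka * Yc S r) = coeff Wb j"
    by (simp add: Wb_def coeff_mult' sum_distrib_right Delta2_coef Yc add.commute)
qed (simp_all add: degree_step)

lemma V_coef: "V_coef (Suc k) S = mcoef V" and W_coef: "W_coef (Suc k) S = coeff W"
  by (simp_all add: V_coef_def W_coef_def V_def W_def c_nonzero Va_coef Wa_coef Vb_coef Wb_coef)

lemma degree_V: "mat_degree_le V (V_deg (Suc k) S)" and degree_W: "degree W \<le> W_deg (Suc k) S"
  by (simp_all add: V_def W_def V_deg_def W_deg_def c_nonzero degree_step)

lemma Theta_coef: "Theta_coef (Suc k) S j = mcoef Theta j"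
proof -
  have "mcoef Theta j = msum k m {..j} (\<lambda>r. msum k m {..j - r} (\<lambda>ka.
       (coeff (Nden k) ka * coeff W r) \<cdot>\<^sub>m mcoef Z (j - r - ka)
       - coeff (Nden k) ka \<cdot>\<^sub>m (mcoef D (j - r - ka) * mcoef V r)))
     - msum k m {..j} (\<lambda>ka. mcoef Phi (j - ka) * mcoef V ka)"
    by (simp add: Theta_def mcoef_minus mcoef_mult mcoef_smult' msum_mult smult_msum msum_minus
        mat_smult_smult[where 'a = complex] mat_mult_smult_left[where 'a = complex] mult.commute del: assoc_mult_mat)
  then show ?thesis
    by (simp add: Theta_coef_def W_coef V_coef d_coef phi_coef coef_eq_mcoef Zc add.commute
        del: assoc_mult_mat)
qed

text \<open>In the bound for \<open>Znext\<close> the maximum of \<open>nnd k + nq\<close> and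
  \<open>ndd k\<close> separates the block \<open>Phi * V\<close> from the terms containing
  \<open>Nden k\<close>; the other maximum covers factors \<open>V\<close> and
  \<open>W\<close>.\<close>

lemma Zc_step: "Zc (step (Suc k) S) = mcoef Znext"
  and degree_Znext: "mat_degree_le Znext (Zdeg (step (Suc k) S))"
  and Yc_step: "Yc (step (Suc k) S) = coeff Ynext"
  and degree_Ynext: "degree Ynext \<le> Ydeg (step (Suc k) S)"
proof -
  define b where "b = next_Zdeg (Suc k) S"
  have b: "b = qhat S + q + max (nnd k + nq) (ndd k) + max (V_deg (Suc k) S) (W_deg (Suc k) S)"
    by (simp add: b_def next_Zdeg_def)
  have q: "Zdeg S + q \<le> qhat S" "Ydeg S \<le> qhat S"
    by (simp_all add: qhat_def)
  have 1: "mat_degree_le (W \<cdot>\<^sub>m (Nden k \<cdot>\<^sub>m Z)) b"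
    by (rule mat_degree_le_smult[OF degree_W mat_degree_le_smult[OF degree_step(1) degZ order_refl]])
      (use q in \<open>simp add: b\<close>)
  have 2: "mat_degree_le (Nden k \<cdot>\<^sub>m D * V) b"
    by (rule mat_degree_le_mult[OF mat_degree_le_smult[OF degree_step(1,3) order_refl] degree_V])
      (use q in \<open>simp_all add: b\<close>)
  have 3: "mat_degree_le (Phi * V) b"
    by (rule mat_degree_le_mult[OF degree_step(5) degree_V]) (simp_all add: b)
  have 4: "mat_degree_le (Psi \<cdot>\<^sub>m V) b"
    by (rule mat_degree_le_smult[OF degree_step(6) degree_V]) (use q in \<open>simp add: b\<close>)
  have Znext: "mat_degree_le Znext b"
    unfolding Znext_def Theta_def
    by (intro mat_degree_le_append_rows mat_degree_le_minus 1 2 3 4) simp_all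
  have Ynext: "degree Ynext \<le> next_Ydeg (Suc k) S"
    unfolding Ynext_def next_Ydeg_def
    using degree_mult_le[of Psi W] degree_step(6) degree_W by simp
  show "mat_degree_le Znext (Zdeg (step (Suc k) S))" "degree Ynext \<le> Ydeg (step (Suc k) S)"
    using Znext Ynext by (simp_all add: step_def b_def)
  have "upto_deg b (0\<^sub>m (Suc k) m) (\<lambda>j. Theta_coef (Suc k) S j
       @\<^sub>r msum 1 m {..j} (\<lambda>ka. psi_coef (Suc k) S (j - ka) \<cdot>\<^sub>m V_coef (Suc k) S ka)) = mcoef Znext"
  proof (rule upto_deg_mcoef)
    fix j
    show "Theta_coef (Suc k) S j
       @\<^sub>r msum 1 m {..j} (\<lambda>ka. psi_coef (Suc k) S (j - ka) \<cdot>\<^sub>m V_coef (Suc k) S ka) = mcoef Znext j"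
      by (simp add: Znext_def mcoef_append_rows Theta_coef psi_coef V_coef mcoef_smult)
  qed (use Znext in \<open>simp_all add: carrier_matI\<close>)
  then show "Zc (step (Suc k) S) = mcoef Znext"
    by (simp add: step_def b_def)
  have "upto_deg (next_Ydeg (Suc k) S) 0 (\<lambda>j. \<Sum>ka\<le>j. psi_coef (Suc k) S (j - ka) * W_coef (Suc k) S ka)
      = coeff Ynext"
  proof (rule upto_deg_coeff)
    fix j
    show "(\<Sum>ka\<le>j. psi_coef (Suc k) S (j - ka) * W_coef (Suc k) S ka) = coeff Ynext j"
      by (simp add: Ynext_def coeff_mult' psi_coef W_coef)
  qed (rule Ynext)
  then show "Yc (step (Suc k) S) = coeff Ynext"
    by (simp add: step_def)
qed

end

section \<open>Correctness\<close>

lemma smult_append_rows: "x \<cdot>\<^sub>m (P @\<^sub>r Q) = (x \<cdot>\<^sub>m P) @\<^sub>r (x \<cdot>\<^sub>m Q)" if "dim_col P = dim_col Q"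
  using that by (intro eq_matI) (auto simp: append_rows_def)

lemma cnj_poly_eqI:
  assumes "fract_cnj (to_fract p) = to_fract p"
  shows "map_poly cnj p = p"
  using assms by (simp add: fract_cnj_to_fract to_fract_eq_iff)

context wmp_correct
begin

lemma anisotropic_M: "anisotropic m (ratmat M)" and anisotropic_N: "anisotropic n (ratmat N)"
  using posM posN by (simp_all add: pos_def_imp_anisotropic)

lemma anisotropic_Nlead: "i \<le> n \<Longrightarrow> anisotropic i (ratmat (Nlead i))"
proof -
  assume i: "i \<le> n"
  have "ratmat (Nlead i) = leading_submat i (ratmat N)"
    using i by (intro eq_matI) (auto simp: leading_submat_def)
  then show ?thesis
    using anisotropic_leading_submat[OF anisotropic_N i] by simp
qed

text \<open>The induction invariant. Besides correctness it carries that \<open>Y\<close> is nonzero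
  and real, which the next step needs for its adjoints.\<close>

definition correct_state where
  "correct_state i S Z Y \<longleftrightarrow>
     Z \<in> carrier_mat i m \<and> Zc S = mcoef Z \<and> mat_degree_le Z (Zdeg S) \<and>
     Yc S = coeff Y \<and> degree Y \<le> Ydeg S \<and> Y \<noteq> 0 \<and> map_poly cnj Y = Y \<and>
     is_weighted_MP (ratmat M) (ratmat (Nlead i)) (ratmat (Ahat i)) (inverse (to_fract Y) \<cdot>\<^sub>m ratmat Z)"

lemma Ahat_1: "Ahat 1 = acol 1"
  by (rule eq_matI) (auto simp: Ahat_def acol_def)

text \<open>The inverse of a nonzero column is \<open>a^* M / (a^* M a)\<close>, with nonzero
  denominator by anisotropy. For a zero column this quotient would be \<open>0 / 0\<close>, whence
  the separate denominator 1.\<close>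

lemma correct_init_state: "\<exists>Z Y. correct_state 1 init_state Z Y"
proof (cases "acol 1 = 0\<^sub>m m 1")
  case True
  have "acol 1 \<in> carrier_mat m 1"
    by (simp add: carrier_matI)
  from mcoef_eq_0_iff[OF this] True
  have "init_state = \<lparr> Zc = (\<lambda>j. 0\<^sub>m 1 m), Yc = (\<lambda>j. if j = 0 then 1 else 0),
      Zdeg = q + mq, Ydeg = 2 * q + mq \<rparr>"
    by (simp add: init_state_def coef_eq_mcoef)
  moreover have "mcoef (0\<^sub>m 1 m) = (\<lambda>j. 0\<^sub>m 1 m)"
    by (intro ext eq_matI) (simp_all add: index_mcoef)
  moreover have "coeff 1 = (\<lambda>j. if j = 0 then 1 else 0 :: complex)"
    by (simp add: fun_eq_iff)
  moreover have "mat_degree_le (0\<^sub>m 1 m) (q + mq)"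
    by (simp add: mat_degree_le_def)
  moreover have ratmat_0: "ratmat (0\<^sub>m k l) = 0\<^sub>m k l" for k l
    by (simp add: ratmat_eq_0_iff)
  have "is_weighted_MP (ratmat M) (ratmat (Nlead 1)) (ratmat (Ahat 1)) (0\<^sub>m 1 m)"
    unfolding is_weighted_MP_def Ahat_1 True ratmat_0
    by (intro conjI) (simp_all add: mat_mult_assoc)
  ultimately have "correct_state 1 init_state (0\<^sub>m 1 m) 1"
    by (simp add: correct_state_def ratmat_0 mat_smult_one)
  then show ?thesis
    by blast
next
  case False
  define Z where "Z = polymat_adjoint (acol 1) * M"
  define Y where "Y = (Z * acol 1) $$ (0, 0)"
  have [simp]: "dim_row Z = 1" "dim_col Z = m"
    by (simp_all add: Z_def)
  have deg_acol: "mat_degree_le (acol 1) q"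
    using n by (simp add: degree_acol)
  have degZ: "mat_degree_le Z (q + mq)"
    unfolding Z_def
    by (rule mat_degree_le_mult[OF mat_degree_le_adjoint[OF deg_acol] degM]) simp_all
  have "mat_degree_le (Z * acol 1) (2 * q + mq)"
    by (rule mat_degree_le_mult[OF degZ deg_acol]) simp_all
  from mat_degree_leD[OF this, of 0 0] have degY: "degree Y \<le> 2 * q + mq"
    by (simp add: Y_def del: index_mult_mat(1))
  have Zc: "upto_deg (q + mq) (0\<^sub>m 1 m)
      (\<lambda>j. msum 1 m {..j} (\<lambda>k. mat_adjoint (a_coef 1 (j - k)) * M_coef k)) = mcoef Z"
  proof (rule upto_deg_mcoef)
    fix j
    show "msum 1 m {..j} (\<lambda>k. mat_adjoint (a_coef 1 (j - k)) * M_coef k) = mcoef Z j"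
      by (simp add: Z_def mcoef_mult mcoef_adjoint coef_eq_mcoef)
  qed (simp_all add: degZ carrier_matI)
  have Yc: "upto_deg (2 * q + mq) 0 (\<lambda>j. \<Sum>r\<le>j. \<Sum>k\<le>j - r.
      (mat_adjoint (a_coef 1 (j - k - r)) * M_coef k * a_coef 1 r) $$ (0, 0)) = coeff Y"
  proof (rule upto_deg_coeff)
    fix j
    have "coeff Y j = mcoef (Z * acol 1) j $$ (0, 0)"
      by (simp add: Y_def index_mcoef del: index_mult_mat(1))
    also have "\<dots> = (\<Sum>r\<le>j. \<Sum>k\<le>j - r.
        (mat_adjoint (mcoef (acol 1) (j - r - k)) * mcoef M k * mcoef (acol 1) r) $$ (0, 0))"
      by (simp add: Z_def mcoef_mult mcoef_adjoint msum_mult index_msum del: assoc_mult_mat index_mult_mat(1))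
    finally show "(\<Sum>r\<le>j. \<Sum>k\<le>j - r.
        (mat_adjoint (a_coef 1 (j - k - r)) * M_coef k * a_coef 1 r) $$ (0, 0)) = coeff Y j"
      by (simp add: coef_eq_mcoef add.commute del: assoc_mult_mat index_mult_mat(1))
  qed (rule degY)
  have "acol 1 \<in> carrier_mat m 1"
    by (simp add: carrier_matI)
  from mcoef_eq_0_iff[OF this] False have init:
    "init_state = \<lparr> Zc = mcoef Z, Yc = coeff Y, Zdeg = q + mq, Ydeg = 2 * q + mq \<rparr>"
    by (simp only: init_state_def Zc Yc) (simp add: coef_eq_mcoef)
  define a where "a = ratmat (acol 1)"
  define w where "w = to_fract Y"
  note [simp] = anisotropicD[OF anisotropic_M]
  have [simp]: "dim_row a = m" "dim_col a = 1"
    by (simp_all add: a_def)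
  have Z_eq: "ratmat Z = ratmat_adjoint a * ratmat M"
    by (simp add: Z_def a_def ratmat_mult ratmat_adjoint_ratmat)
  have Q: "ratmat (Z * acol 1) = ratmat_adjoint a * (ratmat M * a)"
    by (simp add: ratmat_mult Z_eq mat_mult_assoc a_def)
  then have w_eq: "w = (ratmat_adjoint a * (ratmat M * a)) $$ (0, 0)"
    by (simp add: w_def Y_def flip: Q del: index_mult_mat(1))
  have w: "ratmat_adjoint a * (ratmat M * a) = w \<cdot>\<^sub>m 1\<^sub>m 1"
    by (rule entry_one_by_one(1)[OF _ w_eq]) (simp add: carrier_matI)
  have w': "ratmat_adjoint a * (ratmat M * (a * P)) = w \<cdot>\<^sub>m P" if "dim_row P = 1" for P
  proof -
    have "ratmat_adjoint a * (ratmat M * (a * P)) = ratmat_adjoint a * (ratmat M * a) * P"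
      using that by (simp add: mat_mult_assoc)
    then show ?thesis
      using that by (simp add: w mat_algebra)
  qed
  have cnj_w: "fract_cnj w = w"
    by (rule entry_one_by_one(2)[OF _ w_eq]) (simp_all add: carrier_matI ratmat_adjoint_mult mat_mult_assoc)
  have w0: "w \<noteq> 0"
  proof
    assume "w = 0"
    then have "ratmat_adjoint a * ratmat M * a = 0\<^sub>m 1 1"
      using w by (simp add: mat_mult_assoc) (intro eq_matI; simp)
    moreover have "a \<noteq> 0\<^sub>m m 1"
      using False by (simp add: a_def ratmat_eq_0_iff)
    moreover have "a \<in> carrier_mat m 1"
      by (simp add: carrier_matI)
    ultimately show False
      using anisotropic_M by (auto simp: anisotropic_def)
  qed
  \<comment> \<open>Here \<open>X a = 1\<close>, so the condition on the second weight is the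
    self-adjointness of \<open>Nlead 1\<close>.\<close>
  have "is_weighted_MP (ratmat M) (ratmat (Nlead 1)) a (inverse w \<cdot>\<^sub>m ratmat Z)"
    using w0 anisotropicD[OF anisotropic_Nlead[of 1]] n
    by (simp add: is_weighted_MP_def Z_eq mat_algebra w w' ratmat_adjoint_algebra fract_cnj_inverse
        cnj_w carrier_matI)
  then have "correct_state 1 init_state Z Y"
    using degZ degY w0 cnj_w
    by (simp add: correct_state_def init carrier_matI cnj_poly_eqI w_def a_def Ahat_1[simplified])
  then show ?thesis
    by blast
qed

end

context wmp_step
begin

lemma correct_step:
  assumes Y0: "Y \<noteq> 0" and cnj_Y: "map_poly cnj Y = Y"
    and MP: "is_weighted_MP (ratmat M) (ratmat (Nlead k)) (ratmat (Ahat k)) (inverse (to_fract Y) \<cdot>\<^sub>m ratmat Z)"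
  shows "correct_state (Suc k) (step (Suc k) S) Znext Ynext"
proof -
  define y where "y = to_fract Y"
  define v where "v = to_fract (Nden k)"
  define Ni where "Ni = map_mat (\<lambda>p. to_fract p / v) (Nnum k)"
  define nn where "nn = mat 1 1 (\<lambda>_. to_fract (N $$ (k, k)))"
  have y0 [simp]: "y \<noteq> 0" and v0 [simp]: "v \<noteq> 0"
    using Y0 Nden[OF k] by (simp_all add: y_def v_def)
  have cnj_y: "fract_cnj y = y"
    by (simp add: y_def fract_cnj_to_fract cnj_Y)
  have "map_poly cnj (Nden k) = Nden k"
    using Nden[OF k] by (intro poly_eqI) (simp add: coeff_map_poly Reals_cnj_iff)
  then have cnj_v: "fract_cnj v = v"
    by (simp add: v_def fract_cnj_to_fract)
  have Ni: "Ni = inverse v \<cdot>\<^sub>m ratmat (Nnum k)"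
    by (rule eq_matI) (simp_all add: Ni_def divide_inverse mult.commute)
  \<comment> \<open>The last row of the larger leading block is the adjoint of its last column
    because \<open>N\<close> is self-adjoint.\<close>
  have N': "four_block_mat (ratmat (Nlead k)) (ratmat (Lcol (Suc k))) (ratmat_adjoint (ratmat (Lcol (Suc k)))) nn
      = ratmat (Nlead (Suc k))"
  proof (rule eq_matI)
    fix i j assume "i < dim_row (ratmat (Nlead (Suc k)))" "j < dim_col (ratmat (Nlead (Suc k)))"
    then have ij: "i < Suc k" "j < Suc k"
      by simp_all
    have "fract_cnj (to_fract (N $$ (j, k))) = to_fract (N $$ (k, j))" if "j < n"
      using index_ratmat_adjoint[of k "ratmat N" j] anisotropicD(2)[OF anisotropic_N] that k
      by simp
    with ij k show "four_block_mat (ratmat (Nlead k)) (ratmat (Lcol (Suc k)))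
        (ratmat_adjoint (ratmat (Lcol (Suc k)))) nn $$ (i, j) = ratmat (Nlead (Suc k)) $$ (i, j)"
      by (auto simp: nn_def leading_submat_def Lcol_def index_ratmat_adjoint less_Suc_eq)
  qed (simp_all add: nn_def)
  have A': "ratmat (Ahat k) @\<^sub>c ratmat (acol (Suc k)) = ratmat (Ahat (Suc k))"
    by (rule eq_matI) (auto simp: append_cols_def Ahat_def acol_def less_Suc_eq)
  interpret P: appended_column m k "ratmat M" "ratmat (Nlead k)" Ni "ratmat (Ahat k)"
    "inverse y \<cdot>\<^sub>m ratmat Z" "ratmat (acol (Suc k))" "ratmat (Lcol (Suc k))" nn
  proof
    show "anisotropic (Suc k) (four_block_mat (ratmat (Nlead k)) (ratmat (Lcol (Suc k)))
        (ratmat_adjoint (ratmat (Lcol (Suc k)))) nn)"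
      using anisotropic_Nlead[of "Suc k"] k by (simp add: N')
    show "ratmat (Nlead k) * Ni = 1\<^sub>m k" "Ni * ratmat (Nlead k) = 1\<^sub>m k"
      using Ninv[OF k] by (simp_all add: inverts_mat_def Ni_def v_def)
  qed (use anisotropic_M MP in \<open>simp_all add: carrier_matI y_def Ni nn_def\<close>)
  have d: "P.d = inverse y \<cdot>\<^sub>m ratmat D"
    by (simp add: P.d_def D_def ratmat_simps mat_algebra)
  have c: "P.c = inverse y \<cdot>\<^sub>m ratmat C"
    by (simp add: P.c_def d C_def ratmat_simps mat_algebra flip: y_def)
  have p: "P.p = inverse (y * v) \<cdot>\<^sub>m ratmat Phi"
    unfolding P.p_def
    by (simp add: Ni Phi_def ratmat_simps mat_algebra flip: y_def)
      (rule eq_matI; simp add: field_simps del: index_mult_mat(1))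
  \<comment> \<open>Both cases leave the same data behind: a row \<open>b = V / W\<close> with
    \<open>W\<close> nonzero and real. The remaining argument no longer distinguishes them.\<close>
  have "\<exists>b. b = inverse (to_fract W) \<cdot>\<^sub>m ratmat V \<and> W \<noteq> 0 \<and> fract_cnj (to_fract W) = to_fract W \<and>
    is_weighted_MP (ratmat M) (ratmat (Nlead (Suc k))) (ratmat (Ahat (Suc k)))
      ((inverse y \<cdot>\<^sub>m ratmat Z - (P.d + P.p) * b) @\<^sub>r b)"
  proof (cases "C = 0\<^sub>m m 1")
    case False
    define w where "w = (ratmat_adjoint P.c * ratmat M * P.c) $$ (0, 0)"
    define b where "b = inverse w \<cdot>\<^sub>m (ratmat_adjoint P.c * ratmat M)"
    have "P.c \<noteq> 0\<^sub>m m 1"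
    proof
      assume "P.c = 0\<^sub>m m 1"
      then have "y \<cdot>\<^sub>m P.c = 0\<^sub>m m 1"
        by simp
      then show False
        using False by (simp add: c mat_algebra ratmat_eq_0_iff)
    qed
    note b = P.weighted_MP_append_independent_column[OF this w_def b_def]
    have "ratmat_adjoint P.c * ratmat M * P.c =
        (inverse y * inverse y) \<cdot>\<^sub>m ratmat (polymat_adjoint C * M * C)"
      by (simp add: c ratmat_simps mat_algebra ratmat_adjoint_algebra ratmat_adjoint_ratmat
          fract_cnj_inverse cnj_y)
    then have "w = inverse y * inverse y * to_fract Wa"
      by (simp add: w_def Wa_def del: index_mult_mat(1))
    then have W: "to_fract W = w * y * y"
      using False by (simp add: W_def field_simps)
    have "b = inverse (to_fract W) \<cdot>\<^sub>m ratmat V"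
      unfolding W using False
      by (simp add: b_def c V_def Va_def ratmat_simps mat_algebra ratmat_adjoint_algebra ratmat_adjoint_ratmat
          fract_cnj_inverse cnj_y flip: y_def)
        (rule eq_matI; simp add: field_simps del: index_mult_mat(1))
    moreover have "fract_cnj (to_fract W) = to_fract W"
      by (simp add: W fract_cnj_mult cnj_y b(3))
    moreover have "W \<noteq> 0"
      using W b(2) by auto
    ultimately show ?thesis
      using b(1) by (auto simp: N' A')
  next
    case True
    define w where "w = (nn + ratmat_adjoint P.d * ratmat (Nlead k) * P.d
        - ratmat_adjoint P.d * ratmat (Lcol (Suc k)) - ratmat_adjoint (ratmat (Lcol (Suc k))) * P.d
        - ratmat_adjoint (ratmat (Lcol (Suc k))) * P.p) $$ (0, 0)"
    define b where "b = inverse w \<cdot>\<^sub>m ((ratmat_adjoint P.d * ratmat (Nlead k)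
        - ratmat_adjoint (ratmat (Lcol (Suc k)))) * (inverse y \<cdot>\<^sub>m ratmat Z))"
    have "P.c = 0\<^sub>m m 1"
      by (simp add: c True) (intro eq_matI; simp)
    note b = P.weighted_MP_append_dependent_column[OF this w_def b_def]
    have "ratmat_adjoint P.d * ratmat (Nlead k) * P.d =
        (inverse y * inverse y) \<cdot>\<^sub>m ratmat (polymat_adjoint D * Nlead k * D)"
      "ratmat_adjoint P.d * ratmat (Lcol (Suc k)) = inverse y \<cdot>\<^sub>m ratmat (polymat_adjoint D * Lcol (Suc k))"
      "ratmat_adjoint (ratmat (Lcol (Suc k))) * P.d = inverse y \<cdot>\<^sub>m ratmat (polymat_adjoint (Lcol (Suc k)) * D)"
      "ratmat_adjoint (ratmat (Lcol (Suc k))) * P.p =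
        inverse (y * v) \<cdot>\<^sub>m ratmat (polymat_adjoint (Lcol (Suc k)) * Phi)"
      by (simp_all add: d p ratmat_simps mat_algebra ratmat_adjoint_algebra ratmat_adjoint_ratmat
          fract_cnj_inverse cnj_y)
    then have w_eq: "w = to_fract (N $$ (k, k))
        + inverse y * inverse y * to_fract ((polymat_adjoint D * Nlead k * D) $$ (0, 0))
        - inverse y * to_fract ((polymat_adjoint D * Lcol (Suc k)) $$ (0, 0))
        - inverse y * to_fract ((polymat_adjoint (Lcol (Suc k)) * D) $$ (0, 0))
        - inverse (y * v) * to_fract ((polymat_adjoint (Lcol (Suc k)) * Phi) $$ (0, 0))"
      unfolding w_def by (simp add: nn_def del: index_mult_mat(1))
    \<comment> \<open>The factor \<open>y * y * v\<close> clears the denominators of all five terms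
      of \<open>w\<close>.\<close>
    have "to_fract Delta2 = w * y * y * v"
      unfolding w_eq by (simp add: Delta2_def field_simps del: index_mult_mat(1) flip: y_def v_def)
    then have W: "to_fract W = w * y * y * v * y * y"
      using True by (simp add: W_def Wb_def flip: y_def)
    have "b = inverse (to_fract W) \<cdot>\<^sub>m ratmat V"
      unfolding W using True b(2)
      by (simp add: b_def d V_def Vb_def Delta1_def ratmat_simps mat_algebra ratmat_adjoint_algebra
          ratmat_adjoint_ratmat fract_cnj_inverse cnj_y flip: y_def v_def)
        (rule eq_matI; simp add: field_simps del: index_mult_mat(1))
    moreover have "fract_cnj (to_fract W) = to_fract W"
      by (simp add: W fract_cnj_mult cnj_y cnj_v b(3))
    moreover have "W \<noteq> 0"
      using W b(2) by auto
    ultimately show ?thesis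
      using b(1) by (auto simp: N' A')
  qed
  then obtain b where b: "b = inverse (to_fract W) \<cdot>\<^sub>m ratmat V"
    and W0: "W \<noteq> 0" and cnj_W: "fract_cnj (to_fract W) = to_fract W"
    and MP': "is_weighted_MP (ratmat M) (ratmat (Nlead (Suc k))) (ratmat (Ahat (Suc k)))
      ((inverse y \<cdot>\<^sub>m ratmat Z - (P.d + P.p) * b) @\<^sub>r b)"
    by blast
  define w where "w = to_fract W"
  have w0 [simp]: "w \<noteq> 0"
    using W0 by (simp add: w_def)
  have Y': "to_fract Ynext = y * v * w"
    by (simp add: Ynext_def Psi_def y_def v_def w_def)
  \<comment> \<open>\<open>Y * Nden * W\<close> is a common denominator of \<open>Z / Y\<close>,
    \<open>D V / (Y W)\<close> and \<open>Phi V / (Y Nden W)\<close>.\<close>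
  have Theta: "inverse (y * v * w) \<cdot>\<^sub>m ratmat Theta = inverse y \<cdot>\<^sub>m ratmat Z - (P.d + P.p) * b"
    by (simp add: Theta_def b d p ratmat_simps mat_algebra flip: v_def w_def)
      (rule eq_matI; simp add: field_simps del: index_mult_mat(1))
  have Psi: "inverse (y * v * w) \<cdot>\<^sub>m ratmat (Psi \<cdot>\<^sub>m V) = b"
    by (simp add: Psi_def b ratmat_simps mat_algebra flip: y_def v_def w_def)
      (rule eq_matI; simp add: field_simps)
  have "inverse (to_fract Ynext) \<cdot>\<^sub>m ratmat Znext =
      (inverse y \<cdot>\<^sub>m ratmat Z - (P.d + P.p) * b) @\<^sub>r b"
    by (simp add: Znext_def ratmat_append_rows smult_append_rows Y' Theta Psi
        del: inverse_mult_distrib)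
  moreover have "map_poly cnj Ynext = Ynext"
    by (rule cnj_poly_eqI) (simp add: Y' fract_cnj_mult cnj_y cnj_v cnj_W w_def)
  moreover have "Ynext \<noteq> 0"
    using Y' by auto
  ultimately show ?thesis
    using MP' Zc_step degree_Znext Yc_step degree_Ynext
    by (simp add: correct_state_def carrier_matI)
qed

end

context wmp_correct
begin

lemma correct_step:
  assumes "correct_state i S Z Y" "1 \<le> i" "i < n"
  shows "\<exists>Z' Y'. correct_state (Suc i) (step (Suc i) S) Z' Y'"
proof -
  interpret wmp_step m q mq nq A M N Nnum Nden nnd ndd n i S Z Y
    by unfold_locales (use assms in \<open>auto simp: correct_state_def\<close>)
  show ?thesis
    using correct_step assms by (auto simp: correct_state_def[of i])
qed

lemma correct_state_state: "1 \<le> i \<Longrightarrow> i \<le> n \<Longrightarrow> \<exists>Z Y. correct_state i (state i) Z Y"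
proof (induction i rule: dec_induct)
  case base
  then show ?case
    using correct_init_state by simp
next
  case (step i)
  then obtain Z Y where "correct_state i (state i) Z Y"
    by auto
  then have "\<exists>Z' Y'. correct_state (Suc i) (wmp_algorithm.step m q mq nq A M N Nnum Nden nnd ndd (Suc i) (state i)) Z' Y'"
    by (rule correct_step) (use step in auto)
  \<comment> \<open>The recursion of \<open>state\<close> is stated for double successors, so the
    predecessor of \<open>i\<close> must be exposed.\<close>
  moreover obtain i' where "i = Suc i'"
    using step by (cases i) auto
  ultimately show ?case
    by simp
qed

text \<open>The degree bounds in the invariant ensure that the finite sums returned by the algorithm
  recover the whole of \<open>Z\<close> and \<open>Y\<close>.\<close>

lemma X_den_X:
  assumes "1 \<le> i" "i \<le> n"
  shows "X_den i \<noteq> 0" and "is_weighted_MP (ratmat M) (ratmat (Nlead i)) (ratmat (Ahat i)) (X i)"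
proof -
  obtain Z Y where ZY: "correct_state i (state i) Z Y"
    using correct_state_state assms by blast
  then have "X_den i = Y"
    by (simp add: X_den_def correct_state_def poly_as_sum_of_monoms')
  moreover have [simp]: "dim_row Z = i" "dim_col Z = m"
    using ZY by (auto simp: correct_state_def)
  moreover have "X_num i = Z"
    using ZY
    by (intro eq_matI)
      (simp_all add: X_num_def correct_state_def index_mcoef poly_as_sum_of_monoms' mat_degree_leD)
  moreover have "map_mat (\<lambda>p. to_fract p / to_fract Y) Z = inverse (to_fract Y) \<cdot>\<^sub>m ratmat Z"
    by (rule eq_matI) (simp_all add: divide_inverse mult.commute)
  ultimately show "X_den i \<noteq> 0"
    and "is_weighted_MP (ratmat M) (ratmat (Nlead i)) (ratmat (Ahat i)) (X i)"
    using ZY by (simp_all add: X_def correct_state_def)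
qed

text \<open>Existence is supplied by the output of the algorithm, uniqueness by anisotropy, so the
  description in \<open>weighted_MP\<close> denotes \<open>X n\<close>.\<close>

theorem X_eq_weighted_MP:
  "(\<forall>i\<in>{1..n}. X_den i \<noteq> 0) \<and>
    (\<exists>!P. is_weighted_MP (ratmat M) (ratmat N) (ratmat A) P) \<and>
    weighted_MP (ratmat M) (ratmat N) (ratmat A) = X n"
proof -
  have "Nlead n = N" "Ahat n = A"
    by (auto simp: leading_submat_def Ahat_def)
  then have Xn: "is_weighted_MP (ratmat M) (ratmat N) (ratmat A) (X n)"
    using X_den_X(2)[of n] n by simp
  have unique: "P = X n" if "is_weighted_MP (ratmat M) (ratmat N) (ratmat A) P" for P
    by (rule weighted_MP_unique[OF anisotropic_M anisotropic_N _ that Xn]) (simp add: carrier_matI)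
  have "weighted_MP (ratmat M) (ratmat N) (ratmat A) = X n"
    unfolding weighted_MP_def using Xn unique by (rule the_equality)
  moreover have "\<exists>!P. is_weighted_MP (ratmat M) (ratmat N) (ratmat A) P"
    using Xn unique by (rule ex1I)
  moreover have "\<forall>i\<in>{1..n}. X_den i \<noteq> 0"
    by (intro ballI X_den_X(1)) simp_all
  ultimately show ?thesis
    by (intro conjI)
qed

end

theorem theorem3p1:
  fixes m n q mq nq :: nat
    and A M N :: "complex poly mat"
    and Nnum :: "nat \<Rightarrow> complex poly mat"
    and Nden :: "nat \<Rightarrow> complex poly"
    and nnd ndd :: "nat \<Rightarrow> nat"
  assumes "1 \<le> n"
    and "A \<in> carrier_mat m n" and "mat_degree_le A q"
    and "mat_degree_le M mq" and "pos_def_ratmat m (ratmat M)"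
    and "mat_degree_le N nq" and "pos_def_ratmat n (ratmat N)"
    and "\<And>k. 1 \<le> k \<Longrightarrow> k < n \<Longrightarrow>
           Nnum k \<in> carrier_mat k k \<and> mat_degree_le (Nnum k) (nnd k)"
    and "\<And>k. 1 \<le> k \<Longrightarrow> k < n \<Longrightarrow>
           Nden k \<noteq> 0 \<and> degree (Nden k) \<le> ndd k \<and> (\<forall>j. coeff (Nden k) j \<in> \<real>)"
    and "\<And>k. 1 \<le> k \<Longrightarrow> k < n \<Longrightarrow>
           inverts_mat (ratmat (leading_submat k N))
             (map_mat (\<lambda>p. to_fract p / to_fract (Nden k)) (Nnum k)) \<and>
           inverts_mat (map_mat (\<lambda>p. to_fract p / to_fract (Nden k)) (Nnum k))
             (ratmat (leading_submat k N))"
  shows "(\<forall>i \<in> {1..n}. wmp_algorithm.X_den m q mq nq A M N Nnum Nden nnd ndd i \<noteq> 0) \<and>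
         (\<exists>!X. is_weighted_MP (ratmat M) (ratmat N) (ratmat A) X) \<and>
         weighted_MP (ratmat M) (ratmat N) (ratmat A)
           = wmp_algorithm.X m q mq nq A M N Nnum Nden nnd ndd n"
proof -
  interpret wmp_correct m q mq nq A M N Nnum Nden nnd ndd n
    by unfold_locales (fact assms)+
  show ?thesis
    by (rule X_eq_weighted_MP)
qed

end
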